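(* Let $(M,g)$ be a compact Riemannian manifold without boundary. Fix $\Lambda>0$ and suppose $f\in L^2(M)$ is $\Lambda$-band-limited and nontrivial. Assume there exists a linear combination $P$ of $k$ Laplace--Beltrami eigenfunctions such that $$\|f-P\|_{L^2(M)}\le\eta\,\|f\|_{L^2(M)}\qquad\text{for some }0<\eta<1.$$ Let $N(\Lambda)=\#\{j\in\mathbb N:\lambda_j\le\Lambda\}$ be the Weyl counting function (with multiplicity). Then $$\mathrm{FR}(f)\le(1+\eta)\sqrt k+\eta\sqrt{N(\Lambda)}.$$
   Context: $\Delta_g$ is the Laplace--Beltrami operator (negative semidefinite), and $L^2(M)$ is taken with respect to the Riemannian volume. Let $\{e_j\}_{j\ge1}$ be an orthonormal basis of $L^2(M)$ with $\Delta_ge_j=-\lambda_j^2e_j$, $\lambda_j\ge0$. The spectral parameters $\lambda$ are the distinct values of the $\lambda_j$, $E_\lambda$ is the orthogonal projection onto the $-\lambda^2$ eigenspace of $\Delta_g$, and $\sum_\lambda$ is the sum over distinct spectral parameters. A function $f\in L^2(M)$ is $\Lambda$-band-limited if $E_\lambda f\equiv0$ for all spectral parameters $\lambda>\Lambda$. Define $$\|f\|_{\widehat\ell^1}:=\sum_\lambda\|E_\lambda f\|_{L^2(M)},\qquad\mathrm{FR}(f):=\frac{\|f\|_{\widehat\ell^1}}{\|f\|_{L^2(M)}}.$$ A Laplace--Beltrami eigenfunction is an element of a single eigenspace of $\Delta_g$; the $k$ eigenfunctions may belong to different eigenspaces. *)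

theory Defs
  imports "HOL-Analysis.Analysis"
begin

text \<open>Smoothness on open subsets of a normed space. In finite dimension,
  \<open>f\<close> is of class \<open>C\<close> to the \<open>k + 1\<close> on an open set iff it is differentiable there and all
  its directional derivatives are of class \<open>C\<close> to the \<open>k\<close>.\<close>

primrec Ck_on :: "nat \<Rightarrow> 'a::real_normed_vector set \<Rightarrow> ('a \<Rightarrow> 'b::real_normed_vector) \<Rightarrow> bool" where
  "Ck_on 0 S f \<longleftrightarrow> continuous_on S f"
| "Ck_on (Suc k) S f \<longleftrightarrow>
     (\<forall>x\<in>S. f differentiable (at x)) \<and>
     (\<forall>v. Ck_on k S (\<lambda>x. frechet_derivative f (at x) v))"

definition smooth_on :: "'a::real_normed_vector set \<Rightarrow> ('a \<Rightarrow> 'b::real_normed_vector) \<Rightarrow> bool" where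
  "smooth_on S f \<longleftrightarrow> (\<forall>k. Ck_on k S f)"


section \<open>Compact Riemannian manifolds\<close>

text \<open>The manifold is the whole type \<open>'m\<close>, and its dimension is \<open>CARD('n)\<close>.
  A chart is a domain \<open>U\<close> with a coordinate map; the values of the latter off \<open>U\<close> are irrelevant.\<close>

type_synonym ('m, 'n) chart = "'m set \<times> ('m \<Rightarrow> real ^ 'n)"

text \<open>\<open>g (U, \<phi>) x\<close> is the matrix of components of the metric in the chart \<open>(U, \<phi>)\<close>, at the
  point of \<open>U\<close> with coordinates \<open>x\<close>; only \<open>x \<in> \<phi> ` U\<close> matters.\<close>

type_synonym ('m, 'n) metric_components = "('m, 'n) chart \<Rightarrow> real ^ 'n \<Rightarrow> real ^ 'n ^ 'n"

definition smooth_atlas :: "('m::t2_space, 'n::finite) chart set \<Rightarrow> bool" where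
  "smooth_atlas A \<longleftrightarrow>
     (\<forall>(U, \<phi>)\<in>A. open U \<and> open (\<phi> ` U) \<and> homeomorphism U (\<phi> ` U) \<phi> (inv_into U \<phi>)) \<and>
     (\<Union>(U, \<phi>)\<in>A. U) = UNIV \<and>
     (\<forall>(U, \<phi>)\<in>A. \<forall>(V, \<psi>)\<in>A. smooth_on (\<phi> ` (U \<inter> V)) (\<psi> \<circ> inv_into U \<phi>))"

definition riemannian_metric ::
    "('m::t2_space, 'n::finite) chart set \<Rightarrow> ('m, 'n) metric_components \<Rightarrow> bool" where
  "riemannian_metric A g \<longleftrightarrow>
     (\<forall>(U, \<phi>)\<in>A. smooth_on (\<phi> ` U) (g (U, \<phi>)) \<and>
        (\<forall>x\<in>\<phi> ` U. transpose (g (U, \<phi>) x) = g (U, \<phi>) x \<and>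
                   (\<forall>v. v \<noteq> 0 \<longrightarrow> v \<bullet> (g (U, \<phi>) x *v v) > 0))) \<and>
     (\<forall>(U, \<phi>)\<in>A. \<forall>(V, \<psi>)\<in>A. \<forall>p\<in>U \<inter> V.
        let J = matrix (frechet_derivative (\<psi> \<circ> inv_into U \<phi>) (at (\<phi> p)))
        in g (U, \<phi>) (\<phi> p) = transpose J ** g (V, \<psi>) (\<psi> p) ** J)"

definition compact_riemannian_manifold ::
    "('m::t2_space, 'n::finite) chart set \<Rightarrow> ('m, 'n) metric_components \<Rightarrow> bool" where
  "compact_riemannian_manifold A g \<longleftrightarrow>
     compact (UNIV :: 'm set) \<and> smooth_atlas A \<and> riemannian_metric A g"

text \<open>The Riemannian volume is the unique Borel measure that has density \<open>sqrt (det g)\<close> with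
  respect to Lebesgue measure in every chart.\<close>

definition riemannian_volume ::
    "('m::t2_space, 'n::finite) chart set \<Rightarrow> ('m, 'n) metric_components \<Rightarrow> 'm measure \<Rightarrow> bool" where
  "riemannian_volume A g vol \<longleftrightarrow>
     sets vol = sets borel \<and>
     (\<forall>(U, \<phi>)\<in>A. \<forall>B\<in>sets borel. B \<subseteq> U \<longrightarrow>
        emeasure vol B = (\<integral>\<^sup>+x\<in>\<phi> ` B. ennreal (sqrt (det (g (U, \<phi>) x))) \<partial>lborel))"

definition smooth_function ::
    "('m::t2_space, 'n::finite) chart set \<Rightarrow> ('m \<Rightarrow> complex) \<Rightarrow> bool" where
  "smooth_function A u \<longleftrightarrow> (\<forall>(U, \<phi>)\<in>A. smooth_on (\<phi> ` U) (u \<circ> inv_into U \<phi>))"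


section \<open>The Laplace--Beltrami operator\<close>

definition partial_deriv :: "'n::finite \<Rightarrow> (real ^ 'n \<Rightarrow> complex) \<Rightarrow> real ^ 'n \<Rightarrow> complex" where
  "partial_deriv i u x = frechet_derivative u (at x) (axis i 1)"

definition local_laplacian ::
    "(real ^ 'n::finite \<Rightarrow> real ^ 'n ^ 'n) \<Rightarrow> (real ^ 'n \<Rightarrow> complex) \<Rightarrow> real ^ 'n \<Rightarrow> complex" where
  "local_laplacian G u x =
     (1 / sqrt (det (G x))) *\<^sub>R
     (\<Sum>i\<in>UNIV. partial_deriv i
        (\<lambda>y. \<Sum>j\<in>UNIV. (sqrt (det (G y)) * matrix_inv (G y) $ i $ j) *\<^sub>R partial_deriv j u y) x)"

text \<open>\<open>has_laplacian A g u w\<close> says that \<open>w\<close> is the Laplacian of the smooth function \<open>u\<close>. The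
  coordinate expression does not depend on the chart, so it is required in all of them.\<close>

definition has_laplacian ::
    "('m::t2_space, 'n::finite) chart set \<Rightarrow> ('m, 'n) metric_components \<Rightarrow>
     ('m \<Rightarrow> complex) \<Rightarrow> ('m \<Rightarrow> complex) \<Rightarrow> bool" where
  "has_laplacian A g u w \<longleftrightarrow>
     smooth_function A u \<and>
     (\<forall>(U, \<phi>)\<in>A. \<forall>p\<in>U. local_laplacian (g (U, \<phi>)) (u \<circ> inv_into U \<phi>) (\<phi> p) = w p)"

definition laplace_eigenspace ::
    "('m::t2_space, 'n::finite) chart set \<Rightarrow> ('m, 'n) metric_components \<Rightarrow>
     real \<Rightarrow> ('m \<Rightarrow> complex) set" where
  "laplace_eigenspace A g \<nu> = {u. has_laplacian A g u (\<lambda>p. \<nu> *\<^sub>R u p)}"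

definition laplace_eigenfunction ::
    "('m::t2_space, 'n::finite) chart set \<Rightarrow> ('m, 'n) metric_components \<Rightarrow>
     ('m \<Rightarrow> complex) \<Rightarrow> bool" where
  "laplace_eigenfunction A g u \<longleftrightarrow> (\<exists>\<nu>. u \<in> laplace_eigenspace A g \<nu>)"

definition eigenfunction_combination ::
    "('m::t2_space, 'n::finite) chart set \<Rightarrow> ('m, 'n) metric_components \<Rightarrow>
     nat \<Rightarrow> ('m \<Rightarrow> complex) \<Rightarrow> bool" where
  "eigenfunction_combination A g k P \<longleftrightarrow>
     (\<exists>c u. (\<forall>i<k. laplace_eigenfunction A g (u i)) \<and> P = (\<lambda>x. \<Sum>i<k. c i * u i x))"


section \<open>Square-integrable functions\<close>

text \<open>Elements of \<open>L\<^sup>2\<close> are represented by functions; equality in \<open>L\<^sup>2\<close> is equality almost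
  everywhere.\<close>

definition L2_space :: "'m measure \<Rightarrow> ('m \<Rightarrow> complex) set" where
  "L2_space M = {f \<in> borel_measurable M. integrable M (\<lambda>x. (cmod (f x))\<^sup>2)}"

definition L2_inner :: "'m measure \<Rightarrow> ('m \<Rightarrow> complex) \<Rightarrow> ('m \<Rightarrow> complex) \<Rightarrow> complex" where
  "L2_inner M f h = (\<integral>x. f x * cnj (h x) \<partial>M)"

definition L2_norm :: "'m measure \<Rightarrow> ('m \<Rightarrow> complex) \<Rightarrow> real" where
  "L2_norm M f = sqrt (\<integral>x. (cmod (f x))\<^sup>2 \<partial>M)"

definition L2_orthonormal_basis :: "'m measure \<Rightarrow> (nat \<Rightarrow> 'm \<Rightarrow> complex) \<Rightarrow> bool" where
  "L2_orthonormal_basis M e \<longleftrightarrow>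
     (\<forall>j. e j \<in> L2_space M) \<and>
     (\<forall>i j. L2_inner M (e i) (e j) = (if i = j then 1 else 0)) \<and>
     (\<forall>f\<in>L2_space M. \<forall>\<epsilon>>0. \<exists>n c. L2_norm M (\<lambda>x. f x - (\<Sum>j<n. c j * e j x)) < \<epsilon>)"

definition orthogonal_projection ::
    "'m measure \<Rightarrow> ('m \<Rightarrow> complex) set \<Rightarrow> ('m \<Rightarrow> complex) \<Rightarrow> ('m \<Rightarrow> complex) \<Rightarrow> bool" where
  "orthogonal_projection M V f h \<longleftrightarrow>
     h \<in> V \<and> (\<forall>v\<in>V. L2_inner M (\<lambda>x. f x - h x) v = 0)"


section \<open>Spectral decomposition\<close>

definition laplace_eigenbasis ::
    "('m::t2_space, 'n::finite) chart set \<Rightarrow> ('m, 'n) metric_components \<Rightarrow> 'm measure \<Rightarrow>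
     (nat \<Rightarrow> 'm \<Rightarrow> complex) \<Rightarrow> (nat \<Rightarrow> real) \<Rightarrow> bool" where
  "laplace_eigenbasis A g vol e lam \<longleftrightarrow>
     L2_orthonormal_basis vol e \<and>
     (\<forall>j. 0 \<le> lam j \<and> e j \<in> laplace_eigenspace A g (- (lam j)\<^sup>2))"

text \<open>The spectral parameters are the elements of \<open>range lam\<close>.
  \<open>is_spectral_projection A g vol \<mu> f h\<close> says \<open>E\<^sub>\<mu> f = h\<close>.\<close>

definition is_spectral_projection ::
    "('m::t2_space, 'n::finite) chart set \<Rightarrow> ('m, 'n) metric_components \<Rightarrow> 'm measure \<Rightarrow>
     real \<Rightarrow> ('m \<Rightarrow> complex) \<Rightarrow> ('m \<Rightarrow> complex) \<Rightarrow> bool" where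
  "is_spectral_projection A g vol \<mu> f h \<longleftrightarrow>
     orthogonal_projection vol (laplace_eigenspace A g (- \<mu>\<^sup>2)) f h"

definition spectral_projection ::
    "('m::t2_space, 'n::finite) chart set \<Rightarrow> ('m, 'n) metric_components \<Rightarrow> 'm measure \<Rightarrow>
     real \<Rightarrow> ('m \<Rightarrow> complex) \<Rightarrow> 'm \<Rightarrow> complex" where
  "spectral_projection A g vol \<mu> f = (SOME h. is_spectral_projection A g vol \<mu> f h)"

definition band_limited ::
    "('m::t2_space, 'n::finite) chart set \<Rightarrow> ('m, 'n) metric_components \<Rightarrow> 'm measure \<Rightarrow>
     (nat \<Rightarrow> real) \<Rightarrow> real \<Rightarrow> ('m \<Rightarrow> complex) \<Rightarrow> bool" where
  "band_limited A g vol lam \<Lambda> f \<longleftrightarrow>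
     (\<forall>\<mu>\<in>range lam. \<mu> > \<Lambda> \<longrightarrow> is_spectral_projection A g vol \<mu> f (\<lambda>_. 0))"

definition fourier_l1_norm ::
    "('m::t2_space, 'n::finite) chart set \<Rightarrow> ('m, 'n) metric_components \<Rightarrow> 'm measure \<Rightarrow>
     (nat \<Rightarrow> real) \<Rightarrow> ('m \<Rightarrow> complex) \<Rightarrow> ennreal" where
  "fourier_l1_norm A g vol lam f =
     (\<Sum>\<^sub>\<infinity>\<mu>\<in>range lam. ennreal (L2_norm vol (spectral_projection A g vol \<mu> f)))"

definition fourier_ratio ::
    "('m::t2_space, 'n::finite) chart set \<Rightarrow> ('m, 'n) metric_components \<Rightarrow> 'm measure \<Rightarrow>
     (nat \<Rightarrow> real) \<Rightarrow> ('m \<Rightarrow> complex) \<Rightarrow> ennreal" where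
  "fourier_ratio A g vol lam f = fourier_l1_norm A g vol lam f / ennreal (L2_norm vol f)"

text \<open>The number of elements as an extended number, so that an infinite set would not count
  as 0 (as it does for \<^const>\<open>card\<close>).\<close>

definition weyl_count :: "(nat \<Rightarrow> real) \<Rightarrow> real \<Rightarrow> ennreal" where
  "weyl_count lam \<Lambda> = emeasure (count_space UNIV) {j. lam j \<le> \<Lambda>}"

definition ennreal_sqrt :: "ennreal \<Rightarrow> ennreal" where
  "ennreal_sqrt x = (if x = \<infinity> then \<infinity> else ennreal (sqrt (enn2real x)))"

end

theory Submission
  imports Defs
begin

text \<open>
  As \<open>f\<close> is band-limited, only the spectral parameters in \<open>[0, \<Lambda>]\<close> contribute to the Fourier ratio.
  The bound is infinite if infinitely many basis elements have such a parameter, so suppose that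
  only \<open>N\<close> of them do. Let \<open>S\<close> be the set of those spectral parameters in \<open>[0, \<Lambda>]\<close> whose eigenspace contains one of the
  \<open>k\<close> eigenfunctions that make up \<open>P\<close> (with respect to a chosen eigenvalue of each), so that \<open>S\<close> has
  at most \<open>k\<close> elements. On \<open>S\<close>, Cauchy--Schwarz and Bessel's inequality bound the sum of the norms
  \<open>\<parallel>E\<^sub>\<mu> f\<parallel>\<close> by \<open>sqrt k \<parallel>f\<parallel>\<close>. Off \<open>S\<close>, \<open>P\<close> has no component in the eigenspace, hence
  \<open>E\<^sub>\<mu> f = E\<^sub>\<mu> (f - P)\<close>, and the same argument bounds the rest of the sum by
  \<open>sqrt N \<parallel>f - P\<parallel> \<le> \<eta> sqrt N \<parallel>f\<parallel>\<close>. This is \<open>fourier_l1_norm_bound\<close>; dividing by \<open>\<parallel>f\<parallel>\<close> gives the theorem.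

  What the argument rests on is that eigenspaces for different eigenvalues are orthogonal
  (\<open>eigenspaces_orthogonal\<close>). It makes Bessel's inequality available, it removes \<open>P\<close> off \<open>S\<close>, and
  together with completeness of the basis it shows that a spectral projection exists
  (\<open>spectral_projection_exists\<close>). Orthogonality is the symmetry of the Laplacian, that is, Green's
  identity \<open>\<integral> (\<Delta>u) cnj v = - \<integral> \<langle>\<nabla>u, \<nabla>v\<rangle>\<close> (lemma \<open>green\<close>), whose right-hand side is Hermitian.

  Green's identity is proved by cutting \<open>v\<close> into pieces supported in single charts
  (\<open>green_in_chart\<close>), where it is integration by parts in Euclidean space, itself a
  consequence of the translation invariance of Lebesgue measure. The local identities fit together
  because the pairing of gradients does not depend on the chart (\<open>chart_pairing_invariant\<close>).
\<close>

section \<open>Continuously differentiable functions\<close>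

text \<open>Two derivatives of the eigenfunctions and one of everything else are all that Green's
  identity consumes, so the calculus is developed for a single continuous derivative. In this class
  the cut-off functions below can be written down by an explicit formula.\<close>

definition C1_on :: "'a::real_normed_vector set \<Rightarrow> ('a \<Rightarrow> 'b::real_normed_vector) \<Rightarrow> bool" where
  "C1_on S f \<longleftrightarrow> Ck_on (Suc 0) S f"

lemma C1_onI:
  assumes "\<And>x. x \<in> S \<Longrightarrow> (f has_derivative f' x) (at x)"
    and "\<And>v. continuous_on S (\<lambda>x. f' x v)"
  shows "C1_on S f"
proof -
  have "frechet_derivative f (at x) = f' x" if "x \<in> S" for x
    using frechet_derivative_at[OF assms(1)[OF that]] by simp
  then have "continuous_on S (\<lambda>x. frechet_derivative f (at x) v)" for v
    using assms(2)[of v] by (simp cong: continuous_on_cong)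
  then show ?thesis
    using assms(1) by (auto simp: C1_on_def differentiable_def)
qed

lemma C1_on_has_derivative:
  "C1_on S f \<Longrightarrow> x \<in> S \<Longrightarrow> (f has_derivative frechet_derivative f (at x)) (at x)"
  by (simp add: C1_on_def frechet_derivative_works)

lemma C1_on_continuous_derivative:
  "C1_on S f \<Longrightarrow> continuous_on S (\<lambda>x. frechet_derivative f (at x) v)"
  by (simp add: C1_on_def)

lemma C1_on_imp_continuous_on: "C1_on S f \<Longrightarrow> continuous_on S f"
  by (auto simp: C1_on_def intro!: differentiable_imp_continuous_on differentiable_at_imp_differentiable_on)

lemma smooth_on_imp_C1_on: "smooth_on S f \<Longrightarrow> C1_on S f"
  unfolding smooth_on_def C1_on_def by blast

lemma smooth_on_imp_C1_on_derivative:
  "smooth_on S f \<Longrightarrow> C1_on S (\<lambda>x. frechet_derivative f (at x) v)"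
  unfolding smooth_on_def C1_on_def by (metis Ck_on.simps(2))

lemma C1_on_open_Un: "open S \<Longrightarrow> open T \<Longrightarrow> C1_on S f \<Longrightarrow> C1_on T f \<Longrightarrow> C1_on (S \<union> T) f"
  by (auto simp: C1_on_def intro: continuous_on_open_Un)

lemma C1_on_transform:
  assumes "C1_on S f" "open S" "\<And>x. x \<in> S \<Longrightarrow> f x = h x"
  shows "C1_on S h"
proof (rule C1_onI)
  show "(h has_derivative frechet_derivative f (at x)) (at x)" if "x \<in> S" for x
    using has_derivative_transform_within_open[OF C1_on_has_derivative[OF assms(1) that] assms(2) that]
      assms(3) by blast
qed (rule C1_on_continuous_derivative[OF assms(1)])

lemma C1_on_const [simp]: "C1_on S (\<lambda>_. c)"
  by (rule C1_onI[where f'="\<lambda>_ _. 0"]) auto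

lemma C1_on_bounded_linear:
  assumes "bounded_linear L" "C1_on S f"
  shows "C1_on S (\<lambda>x. L (f x))"
  by (rule C1_onI[where f'="\<lambda>x v. L (frechet_derivative f (at x) v)"])
    (auto intro!: bounded_linear.has_derivative[OF assms(1)] C1_on_has_derivative[OF assms(2)]
      bounded_linear.continuous_on[OF assms(1)] C1_on_continuous_derivative[OF assms(2)])

lemma C1_on_bounded_bilinear:
  assumes bil: "bounded_bilinear B" and f: "C1_on S f" and h: "C1_on S h"
  shows "C1_on S (\<lambda>x. B (f x) (h x))"
proof (rule C1_onI)
  show "((\<lambda>x. B (f x) (h x)) has_derivative
      (\<lambda>v. B (f x) (frechet_derivative h (at x) v) + B (frechet_derivative f (at x) v) (h x))) (at x)"
    if "x \<in> S" for x
    using bounded_bilinear.FDERIV[OF bil C1_on_has_derivative[OF f that] C1_on_has_derivative[OF h that]] .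
  show "continuous_on S (\<lambda>x. B (f x) (frechet_derivative h (at x) v) + B (frechet_derivative f (at x) v) (h x))" for v
    by (intro continuous_on_add bounded_bilinear.continuous_on[OF bil] C1_on_imp_continuous_on f h
        C1_on_continuous_derivative)
qed

lemmas C1_on_scaleR = C1_on_bounded_bilinear[OF bounded_bilinear_scaleR]
lemmas C1_on_mult = C1_on_bounded_bilinear[OF bounded_bilinear_mult]
lemmas C1_on_cnj = C1_on_bounded_linear[OF bounded_linear_cnj]

lemma C1_on_add:
  assumes "C1_on S f" "C1_on S h"
  shows "C1_on S (\<lambda>x. f x + h x)"
  by (rule C1_onI[where f'="\<lambda>x v. frechet_derivative f (at x) v + frechet_derivative h (at x) v"])
    (auto intro!: has_derivative_add continuous_on_add C1_on_has_derivative C1_on_continuous_derivative assms)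

lemma C1_on_sum: "(\<And>i. i \<in> I \<Longrightarrow> C1_on S (f i)) \<Longrightarrow> C1_on S (\<lambda>x. \<Sum>i\<in>I. f i x)"
  by (induction I rule: infinite_finite_induct) (auto intro!: C1_on_add)

lemma C1_on_prod:
  fixes f :: "'i \<Rightarrow> 'a::real_normed_vector \<Rightarrow> 'b::{real_normed_algebra_1,comm_monoid_mult}"
  shows "(\<And>i. i \<in> I \<Longrightarrow> C1_on S (f i)) \<Longrightarrow> C1_on S (\<lambda>x. \<Prod>i\<in>I. f i x)"
  by (induction I rule: infinite_finite_induct) (auto intro!: C1_on_mult)

lemma linear_expand_Basis:
  fixes L :: "'b::euclidean_space \<Rightarrow> 'c::real_normed_vector"
  assumes "linear L"
  shows "L w = (\<Sum>b\<in>Basis. (w \<bullet> b) *\<^sub>R L b)"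
proof -
  have "L w = L (\<Sum>b\<in>Basis. (w \<bullet> b) *\<^sub>R b)" by (simp add: euclidean_representation)
  also have "\<dots> = (\<Sum>b\<in>Basis. (w \<bullet> b) *\<^sub>R L b)"
    by (simp add: linear_sum[OF assms] linear_cmul[OF assms])
  finally show ?thesis .
qed

text \<open>The derivative of a composition at \<open>x\<close> is \<open>Df(T x)\<close> applied to a vector that itself moves with
  \<open>x\<close>, whereas continuity is known for each fixed vector only; expanding the moving vector in the
  standard basis bridges the gap.\<close>

lemma C1_on_compose:
  fixes T :: "'a::real_normed_vector \<Rightarrow> 'b::euclidean_space" and f :: "'b \<Rightarrow> 'c::real_normed_vector"
  assumes T: "C1_on S T" and f: "C1_on R f" and TR: "T ` S \<subseteq> R"
  shows "C1_on S (\<lambda>x. f (T x))"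
proof (rule C1_onI)
  let ?DT = "\<lambda>x. frechet_derivative T (at x)" and ?Df = "\<lambda>y. frechet_derivative f (at y)"
  show "((\<lambda>x. f (T x)) has_derivative (\<lambda>v. ?Df (T x) (?DT x v))) (at x)" if "x \<in> S" for x
    using has_derivative_compose[OF C1_on_has_derivative[OF T that] C1_on_has_derivative[OF f]] that TR by blast
  have eq: "?Df (T x) (?DT x v) = (\<Sum>b\<in>Basis. (?DT x v \<bullet> b) *\<^sub>R ?Df (T x) b)" if "x \<in> S" for x v
    using that TR by (intro linear_expand_Basis has_derivative_linear[OF C1_on_has_derivative[OF f]]) blast
  have "continuous_on S (\<lambda>x. \<Sum>b\<in>Basis. (?DT x v \<bullet> b) *\<^sub>R ?Df (T x) b)" for v
    using TR
    by (intro continuous_intros C1_on_continuous_derivative[OF T]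
        continuous_on_compose2[OF C1_on_continuous_derivative[OF f] C1_on_imp_continuous_on[OF T]])
  then show "continuous_on S (\<lambda>x. ?Df (T x) (?DT x v))" for v
    using eq by (simp cong: continuous_on_cong)
qed

lemma C1_on_real_function:
  fixes q q' :: "real \<Rightarrow> real"
  assumes "\<And>t. t \<in> R \<Longrightarrow> (q has_real_derivative q' t) (at t)" "continuous_on R q'"
  shows "C1_on R q"
  by (rule C1_onI[where f'="\<lambda>t v. q' t * v"])
    (use assms in \<open>auto simp: has_field_derivative_def intro!: continuous_intros\<close>)

lemma C1_on_sqrt: "C1_on S f \<Longrightarrow> (\<And>x. x \<in> S \<Longrightarrow> 0 < f x) \<Longrightarrow> C1_on S (\<lambda>x. sqrt (f x))"
  by (rule C1_on_compose[where R="{0<..}"], assumption,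
      rule C1_on_real_function[where q'="\<lambda>t. inverse (sqrt t) / 2"])
    (auto intro!: continuous_intros DERIV_real_sqrt)

lemma C1_on_inverse:
  fixes f :: "'a::real_normed_vector \<Rightarrow> real"
  shows "C1_on S f \<Longrightarrow> (\<And>x. x \<in> S \<Longrightarrow> f x \<noteq> 0) \<Longrightarrow> C1_on S (\<lambda>x. inverse (f x))"
  by (rule C1_on_compose[where R="- {0}"], assumption,
      rule C1_on_real_function[where q'="\<lambda>t. - (inverse t ^ Suc (Suc 0))"])
    (auto intro!: continuous_intros DERIV_inverse simp del: power_Suc)

text \<open>The square makes the positive part of \<open>r - \<bar>x - a\<bar>\<^sup>2\<close> differentiable across the sphere where it
  reaches zero.\<close>

lemma C1_on_bump: "C1_on UNIV (\<lambda>x::'a::euclidean_space. (max 0 (r - (norm (x - a))\<^sup>2))\<^sup>2)"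
proof -
  have 1: "C1_on UNIV (\<lambda>t::real. (max 0 t)\<^sup>2)"
  proof (rule C1_on_real_function)
    show "((\<lambda>t. (max 0 t)\<^sup>2) has_real_derivative 2 * max 0 t) (at t)" for t :: real
    proof (cases t "0::real" rule: linorder_cases)
      case less
      have "((\<lambda>t. 0) has_real_derivative 2 * max 0 t) (at t)" using less by simp
      then show ?thesis
        by (rule has_field_derivative_transform_within_open[of _ _ _ "{..<0}"]) (use less in auto)
    next
      case greater
      have "((\<lambda>t. t\<^sup>2) has_real_derivative 2 * max 0 t) (at t)" 
        using greater by (auto intro!: derivative_eq_intros)
      then show ?thesis
        by (rule has_field_derivative_transform_within_open[of _ _ _ "{0<..}"]) (use greater in auto)
    next
      case equal
      have "((\<lambda>h::real. (max 0 h)\<^sup>2 / h) \<longlongrightarrow> 0) (at 0)"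
      proof (rule Lim_null_comparison)
        show "((\<lambda>h::real. \<bar>h\<bar>) \<longlongrightarrow> 0) (at 0)" by (simp add: tendsto_rabs_zero)
        show "\<forall>\<^sub>F h in at 0. norm ((max 0 h)\<^sup>2 / h) \<le> \<bar>h::real\<bar>"
          by (rule always_eventually) (auto simp: max_def power2_eq_square)
      qed
      with equal show ?thesis by (simp add: DERIV_def)
    qed
    show "continuous_on UNIV (\<lambda>t::real. 2 * max 0 t)" by (intro continuous_intros)
  qed
  have 2: "C1_on UNIV (\<lambda>x::'a. r - (norm (x - a))\<^sup>2)"
    by (rule C1_onI[where f'="\<lambda>x v. - (2 * ((x - a) \<bullet> v))"])
      (auto simp: power2_norm_eq_inner inner_commute intro!: derivative_eq_intros continuous_intros)
  show ?thesis using C1_on_compose[OF 2 1] by simp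
qed

section \<open>Integration by parts in Euclidean space\<close>

lemma frechet_derivative_outside_support:
  assumes "closed K" "x \<notin> K" "\<And>x. x \<notin> K \<Longrightarrow> f x = 0"
  shows "frechet_derivative f (at x) v = 0"
proof -
  have "((\<lambda>_. 0) has_derivative (\<lambda>_. 0)) (at x)" by simp
  then have "(f has_derivative (\<lambda>_. 0)) (at x)"
    by (rule has_derivative_transform_within_open[of _ _ _ _ "- K"]) (use assms in auto)
  then show ?thesis using frechet_derivative_at by metis
qed

lemma integrable_continuous_compact_support:
  fixes f :: "'a::euclidean_space \<Rightarrow> 'b::{banach, second_countable_topology}"
  assumes "continuous_on UNIV f" "compact K" "\<And>x. x \<notin> K \<Longrightarrow> f x = 0"
  shows "integrable lborel f"
proof -
  have "integrable lborel (\<lambda>x. indicator K x *\<^sub>R f x)"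
    using borel_integrable_compact[OF assms(2) continuous_on_subset[OF assms(1)]]
    by (simp add: set_integrable_def)
  also have "(\<lambda>x. indicator K x *\<^sub>R f x) = f" using assms(3) by (auto simp: indicator_def)
  finally show ?thesis .
qed

text \<open>The difference quotients of \<open>H\<close> along \<open>v\<close> have integral zero because Lebesgue measure is
  translation invariant, and they converge to the derivative. The mean value theorem bounds them by
  a constant on one fixed ball, so dominated convergence applies.\<close>

lemma integral_derivative_compact_support:
  fixes H :: "'a::euclidean_space \<Rightarrow> complex"
  assumes H: "C1_on UNIV H" and K: "compact K" "\<And>x. x \<notin> K \<Longrightarrow> H x = 0"
  shows "(\<integral>x. frechet_derivative H (at x) v \<partial>lborel) = 0"
proof -
  define D where "D = (\<lambda>x. frechet_derivative H (at x) v)"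
  have contH: "continuous_on UNIV H" using C1_on_imp_continuous_on[OF H] .
  have contD: "continuous_on UNIV D" unfolding D_def by (rule C1_on_continuous_derivative[OF H])
  have D0: "D x = 0" if "x \<notin> K" for x
    unfolding D_def using frechet_derivative_outside_support[of K x H] compact_imp_closed K that by blast
  obtain R where R: "\<And>x. x \<in> K \<Longrightarrow> norm x \<le> R" 
    using compact_imp_bounded[OF K(1)] unfolding bounded_iff by blast
  have "bounded (D ` K)"
    using compact_imp_bounded[OF compact_continuous_image[OF continuous_on_subset[OF contD] K(1)]] by simp
  then obtain C where C: "\<And>x. x \<in> K \<Longrightarrow> norm (D x) \<le> C" by (auto simp: bounded_iff)
  have DC: "norm (D x) \<le> max 0 C" for x using C[of x] D0[of x] by (cases "x \<in> K") auto
  define s where "s = (\<lambda>n x. of_nat (Suc n) * (H (x + (1 / real (Suc n)) *\<^sub>R v) - H x))"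
  have intH: "integrable lborel H" by (rule integrable_continuous_compact_support[OF contH K]) 
  have shift: "integrable lborel (\<lambda>x. H (x + a))" "(\<integral>x. H (x + a) \<partial>lborel) = (\<integral>x. H x \<partial>lborel)" for a
  proof -
    have [measurable]: "H \<in> borel_measurable borel" by (rule borel_measurable_continuous_onI[OF contH])
    have "integrable (distr lborel borel ((+) a)) H" using intH by (simp add: lborel_distr_plus)
    then show "integrable lborel (\<lambda>x. H (x + a))" by (subst (asm) integrable_distr_eq) (auto simp: add.commute)
    have "(\<integral>x. H x \<partial>lborel) = (\<integral>x. H x \<partial>distr lborel borel ((+) a))" using lborel_distr_plus[of a] by simp
    also have "\<dots> = (\<integral>x. H (x + a) \<partial>lborel)" by (subst integral_distr) (auto simp: add.commute)
    finally show "(\<integral>x. H (x + a) \<partial>lborel) = (\<integral>x. H x \<partial>lborel)" by simp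
  qed
  have ints: "(\<integral>x. s n x \<partial>lborel) = 0" for n
    unfolding s_def using shift intH by simp
  have line: "((\<lambda>t. H (x + t *\<^sub>R v)) has_vector_derivative D (x + t *\<^sub>R v)) (at t)" for x t
  proof -
    have "linear (frechet_derivative H (at (x + t *\<^sub>R v)))"
      by (rule has_derivative_linear[OF C1_on_has_derivative[OF H]]) simp
    then have "frechet_derivative H (at (x + t *\<^sub>R v)) (c *\<^sub>R v) = c *\<^sub>R D (x + t *\<^sub>R v)" for c
      by (simp add: D_def linear_cmul)
    moreover have "((\<lambda>t. H (x + t *\<^sub>R v)) has_derivative (\<lambda>c. frechet_derivative H (at (x + t *\<^sub>R v)) (c *\<^sub>R v))) (at t)"
      by (rule has_derivative_compose[of "\<lambda>t. x + t *\<^sub>R v", OF _ C1_on_has_derivative[OF H]])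
        (auto intro!: derivative_eq_intros)
    ultimately show ?thesis by (simp add: has_vector_derivative_def)
  qed
  \<comment> \<open>The step length is at most 1, so a quotient can be nonzero only within \<open>norm v\<close> of \<open>K\<close>.\<close>
  have bound: "norm (s n x) \<le> indicator (cball 0 (R + norm v)) x * max 0 C" for n x
  proof (cases "norm x \<le> R + norm v")
    case True
    have "norm (H (x + (1 / real (Suc n)) *\<^sub>R v) - H (x + 0 *\<^sub>R v)) \<le> max 0 C * norm (1 / real (Suc n) - 0)"
    proof (rule differentiable_bound[OF convex_UNIV])
      show "((\<lambda>t. H (x + t *\<^sub>R v)) has_derivative (\<lambda>h. h *\<^sub>R D (x + t *\<^sub>R v))) (at t within UNIV)" for t
        using line[of x t] by (simp add: has_vector_derivative_def)
      show "onorm (\<lambda>h. h *\<^sub>R D (x + t *\<^sub>R v)) \<le> max 0 C" for t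
        using DC[of "x + t *\<^sub>R v"] by (intro onorm_le) (auto simp: mult.commute intro!: mult_left_mono)
    qed auto
    then have "norm (H (x + (1 / real (Suc n)) *\<^sub>R v) - H x) \<le> max 0 C / real (Suc n)"
      by simp
    then have "real (Suc n) * norm (H (x + (1 / real (Suc n)) *\<^sub>R v) - H x) \<le> max 0 C"
      by (simp add: field_simps del: of_nat_Suc)
    moreover have "norm (s n x) = real (Suc n) * norm (H (x + (1 / real (Suc n)) *\<^sub>R v) - H x)"
      by (simp only: s_def norm_mult norm_of_nat)
    ultimately show ?thesis using True by simp
  next
    case False
    have n1: "norm ((1 / real (Suc n)) *\<^sub>R v) \<le> norm v"
      using mult_right_mono[of "1 / real (Suc n)" 1 "norm v"] by simp
    have "x \<notin> K" using R[of x] False norm_ge_zero[of v] by linarith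
    moreover have "x + (1 / real (Suc n)) *\<^sub>R v \<notin> K"
      using R[of "x + (1 / real (Suc n)) *\<^sub>R v"] False n1 norm_triangle_ineq4[of "x + (1 / real (Suc n)) *\<^sub>R v" "(1 / real (Suc n)) *\<^sub>R v"]
      by auto
    ultimately show ?thesis using K(2) False by (simp add: s_def)
  qed
  have lim: "(\<lambda>n. s n x) \<longlonglongrightarrow> D x" for x
  proof -
    have "((\<lambda>h. norm (H (x + h *\<^sub>R v) - H x - h *\<^sub>R D x) / norm h) \<longlongrightarrow> 0) (at 0)"
      using line[of x 0] by (simp add: has_vector_derivative_def has_derivative_at)
    then have "((\<lambda>h. norm ((H (x + h *\<^sub>R v) - H x) /\<^sub>R h - D x)) \<longlongrightarrow> 0) (at 0)"
    proof (rule tendsto_cong[THEN iffD1, rotated])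
      show "\<forall>\<^sub>F h in at 0. norm (H (x + h *\<^sub>R v) - H x - h *\<^sub>R D x) / norm h
          = norm ((H (x + h *\<^sub>R v) - H x) /\<^sub>R h - D x)"
        unfolding eventually_at_filter
      proof (rule always_eventually, intro allI impI)
        fix h :: real assume h: "h \<noteq> 0"
        then have "(H (x + h *\<^sub>R v) - H x) /\<^sub>R h - D x = (H (x + h *\<^sub>R v) - H x - h *\<^sub>R D x) /\<^sub>R h"
          by (simp add: scaleR_diff_right)
        then show "norm (H (x + h *\<^sub>R v) - H x - h *\<^sub>R D x) / norm h
          = norm ((H (x + h *\<^sub>R v) - H x) /\<^sub>R h - D x)"
          by (simp only: norm_scaleR) (simp add: divide_inverse)
      qed
    qed
    then have "((\<lambda>h. (H (x + h *\<^sub>R v) - H x) /\<^sub>R h) \<longlongrightarrow> D x) (at 0)"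
      by (rule LIM_zero_cancel[OF tendsto_norm_zero_cancel])
    then have "(\<lambda>n. (H (x + (1 / real (Suc n)) *\<^sub>R v) - H x) /\<^sub>R (1 / real (Suc n))) \<longlonglongrightarrow> D x"
      by (rule filterlim_compose) (auto intro!: LIMSEQ_Suc lim_1_over_n simp: filterlim_at simp del: of_nat_Suc)
    then show ?thesis by (simp add: s_def scaleR_conv_of_real)
  qed
  have "(\<lambda>n. \<integral>x. s n x \<partial>lborel) \<longlonglongrightarrow> (\<integral>x. D x \<partial>lborel)"
  proof (rule integral_dominated_convergence[where w="\<lambda>x. indicator (cball 0 (R + norm v)) x * max 0 C"])
    show "D \<in> borel_measurable lborel" using borel_measurable_continuous_onI[OF contD] by simp
    show "s n \<in> borel_measurable lborel" for n
      unfolding s_def using shift intH by measurable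
    show "integrable lborel (\<lambda>x. indicator (cball 0 (R + norm v)) x * max 0 C)"
      by (intro integrable_mult_left integrable_real_indicator) (use emeasure_bounded_finite[OF bounded_cball] in auto)
  qed (use bound lim in auto)
  with ints have "(\<lambda>n. 0::complex) \<longlonglongrightarrow> (\<integral>x. D x \<partial>lborel)" by simp
  then show ?thesis unfolding D_def using LIMSEQ_unique tendsto_const by metis
qed

text \<open>The product \<open>F w\<close>, extended by zero, is \<open>C\<^sup>1\<close> on the whole space: on the open set \<open>S\<close> by the
  product rule and on the open complement of \<open>K\<close> because it vanishes there. The integral of its
  derivative is therefore zero.\<close>

lemma integration_by_parts_compact_support:
  fixes F w :: "'a::euclidean_space \<Rightarrow> complex"
  assumes S: "open S" and F: "C1_on S F" and w: "C1_on S w"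
    and K: "compact K" "K \<subseteq> S" "\<And>x. x \<in> S \<Longrightarrow> x \<notin> K \<Longrightarrow> w x = 0"
  shows "integrable lborel (\<lambda>x. indicator S x *\<^sub>R (frechet_derivative F (at x) v * w x))" (is "integrable _ ?a")
    and "integrable lborel (\<lambda>x. indicator S x *\<^sub>R (F x * frechet_derivative w (at x) v))" (is "integrable _ ?b")
    and "(\<integral>x. indicator S x *\<^sub>R (frechet_derivative F (at x) v * w x) \<partial>lborel)
       = - (\<integral>x. indicator S x *\<^sub>R (F x * frechet_derivative w (at x) v) \<partial>lborel)"
proof -
  have oK: "open (- K)" "S \<union> - K = UNIV" using K compact_imp_closed by auto
  have dw0: "frechet_derivative w (at x) v = 0" if "x \<in> S" "x \<notin> K" for x
  proof -
    have "((\<lambda>_. 0) has_derivative (\<lambda>_. 0)) (at x)" by simp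
    then have "(w has_derivative (\<lambda>_. 0)) (at x)"
      by (rule has_derivative_transform_within_open[of _ _ _ _ "S - K"])
        (use K S that compact_imp_closed in auto)
    then show ?thesis using frechet_derivative_at by metis
  qed
  have ext: "continuous_on UNIV (\<lambda>x. indicator S x *\<^sub>R q x)"
    if "continuous_on S q" "\<And>x. x \<in> S \<Longrightarrow> x \<notin> K \<Longrightarrow> q x = 0" for q :: "'a \<Rightarrow> complex"
  proof -
    have "continuous_on S (\<lambda>x. indicator S x *\<^sub>R q x)"
      using that(1) by (rule continuous_on_eq) auto
    moreover have "continuous_on (- K) (\<lambda>x. indicator S x *\<^sub>R q x)"
      by (rule continuous_on_eq[of _ "\<lambda>_. 0"]) (use that in \<open>auto simp: indicator_def\<close>)
    ultimately show ?thesis using continuous_on_open_Un[OF S oK(1)] oK(2) by metis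
  qed
  show a: "integrable lborel ?a"
    using K by (intro integrable_continuous_compact_support[OF ext K(1)] continuous_intros
        C1_on_continuous_derivative[OF F] C1_on_imp_continuous_on[OF w])
      (auto simp: indicator_def)
  show b: "integrable lborel ?b"
    using K dw0 by (intro integrable_continuous_compact_support[OF ext K(1)] continuous_intros
        C1_on_continuous_derivative[OF w] C1_on_imp_continuous_on[OF F])
      (auto simp: indicator_def)
  define H where "H = (\<lambda>x. if x \<in> S then F x * w x else 0)"
  have "C1_on S H" by (rule C1_on_transform[OF C1_on_mult[OF F w] S]) (simp add: H_def)
  moreover have "C1_on (- K) H" 
    by (rule C1_on_transform[OF C1_on_const[of _ 0] oK(1)]) (use K(3) in \<open>auto simp: H_def\<close>)
  ultimately have H: "C1_on UNIV H" using C1_on_open_Un[OF S oK(1)] oK(2) by metis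
  have H0: "H x = 0" if "x \<notin> K" for x using K(3) that by (auto simp: H_def)
  have DH: "frechet_derivative H (at x) v = ?a x + ?b x" for x
  proof (cases "x \<in> S")
    case True
    have "((\<lambda>x. F x * w x) has_derivative (\<lambda>v. F x * frechet_derivative w (at x) v + frechet_derivative F (at x) v * w x)) (at x)"
      by (rule has_derivative_mult[OF C1_on_has_derivative[OF F True] C1_on_has_derivative[OF w True]])
    then have "(H has_derivative (\<lambda>v. F x * frechet_derivative w (at x) v + frechet_derivative F (at x) v * w x)) (at x)"
      by (rule has_derivative_transform_within_open[OF _ S True]) (simp add: H_def)
    from frechet_derivative_at[OF this, symmetric] True show ?thesis by simp
  next
    case False
    then have "x \<notin> K" using K by blast
    then show ?thesis
      using frechet_derivative_outside_support[OF compact_imp_closed[OF K(1)] _ H0] False by simp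
  qed
  have "(\<integral>x. ?a x + ?b x \<partial>lborel) = 0"
    using integral_derivative_compact_support[OF H K(1), of v] H0 by (simp only: DH) blast
  then show "(\<integral>x. ?a x \<partial>lborel) = - (\<integral>x. ?b x \<partial>lborel)"
    using a b by (simp add: eq_neg_iff_add_eq_0)
qed

section \<open>Inverse and determinant of the metric matrix\<close>

text \<open>Every matrix on the segment from the identity to \<open>B\<close> is positive definite, hence
  invertible. The determinant thus has no zero along the segment and keeps the sign it has at the
  identity.\<close>

lemma positive_definite_imp_det_pos:
  fixes B :: "real^'n^'n"
  assumes pos: "\<And>v. v \<noteq> 0 \<Longrightarrow> v \<bullet> (B *v v) > 0"
  shows "det B > 0"
proof (rule ccontr)
  assume neg: "\<not> det B > 0"
  define C where "C t = (1 - t) *\<^sub>R mat 1 + t *\<^sub>R B" for t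
  have C0: "det (C 0) = 1" and C1: "det (C 1) = det B" by (simp_all add: C_def det_I)
  have "continuous_on {0..1} (\<lambda>t. det (C t))"
    unfolding det_def C_def by (intro continuous_intros)
  then obtain t where t: "0 \<le> t" "t \<le> 1" "det (C t) = 0"
    using IVT2'[of "\<lambda>t. det (C t)" 1 0 0] C0 C1 neg by force
  then have "\<not> invertible (C t)" by (simp add: invertible_det_nz)
  then obtain v where v: "C t *v v = 0" "v \<noteq> 0"
    by (metis invertible_left_inverse matrix_left_invertible_ker)
  have "v \<bullet> (C t *v v) = (1 - t) * (v \<bullet> v) + t * (v \<bullet> (B *v v))"
    by (simp add: C_def matrix_vector_mult_add_rdistrib scaleR_matrix_vector_assoc[symmetric] inner_add_right)
  moreover have "(1 - t) * (v \<bullet> v) + t * (v \<bullet> (B *v v)) > 0"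
  proof (cases "t = 1")
    case False
    then have "(1 - t) * (v \<bullet> v) > 0" using t v by simp
    moreover have "t * (v \<bullet> (B *v v)) \<ge> 0" using t pos[OF v(2)] by simp
    ultimately show ?thesis by linarith
  qed (use pos[OF v(2)] in simp)
  ultimately show False using v by simp
qed

lemma C1_on_det:
  fixes G :: "'a::real_normed_vector \<Rightarrow> real^'n^'n"
  assumes "\<And>i j. C1_on S (\<lambda>x. G x $ i $ j)"
  shows "C1_on S (\<lambda>x. det (G x))"
  unfolding det_def by (intro C1_on_sum C1_on_mult C1_on_prod C1_on_const assms)

lemma matrix_inv_right_inverse:
  assumes "det B \<noteq> 0"
  shows "(B::real^'n^'n) ** matrix_inv B = mat 1"
proof -
  have "\<exists>C. B ** C = mat 1 \<and> C ** B = mat 1"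
    using assms by (simp add: invertible_det_nz[symmetric] invertible_def)
  then show ?thesis unfolding matrix_inv_def by (metis (mono_tags, lifting) someI_ex)
qed

lemma matrix_inv_unique:
  assumes "(B::real^'n^'n) ** C = mat 1"
  shows "matrix_inv B = C"
proof -
  have "invertible B" using assms invertible_right_inverse by blast
  then have "B ** matrix_inv B = mat 1" 
    using matrix_inv_right_inverse invertible_det_nz by blast
  moreover have "C ** B = mat 1" using assms matrix_left_right_inverse by blast
  ultimately show ?thesis by (metis matrix_mul_assoc matrix_mul_lid matrix_mul_rid)
qed

text \<open>Cramer's rule: the entries of the inverse are rational in the entries of the matrix, which
  is how they inherit differentiability.\<close>

lemma matrix_inv_entry:
  fixes B :: "real^'n^'n"
  assumes "det B \<noteq> 0"
  shows "matrix_inv B $ i $ j = det (\<chi> a b. if b = i then axis j 1 $ a else B $ a $ b) / det B"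
proof -
  have "B *v (matrix_inv B *v axis j 1) = axis j 1"
    by (simp add: matrix_vector_mul_assoc matrix_inv_right_inverse[OF assms])
  then have "matrix_inv B *v axis j 1 =
      (\<chi> k. det (\<chi> a b. if b = k then axis j 1 $ a else B $ a $ b) / det B)"
    using cramer[OF assms] by blast
  moreover have "matrix_inv B $ i $ j = (matrix_inv B *v axis j 1) $ i"
    by (simp add: matrix_vector_mul_component inner_axis)
  ultimately show ?thesis by simp
qed

lemma C1_on_matrix_inv:
  fixes G :: "'a::real_normed_vector \<Rightarrow> real^'n^'n"
  assumes G: "\<And>i j. C1_on S (\<lambda>x. G x $ i $ j)" and S: "open S" and det: "\<And>x. x \<in> S \<Longrightarrow> det (G x) \<noteq> 0"
  shows "C1_on S (\<lambda>x. matrix_inv (G x) $ i $ j)"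
proof -
  have "C1_on S (\<lambda>x. (\<chi> a b. if b = i then axis j 1 $ a else G x $ a $ b) $ a $ b)" for a b
    by (cases "b = i") (use G in auto)
  then have "C1_on S (\<lambda>x. det (\<chi> a b. if b = i then axis j 1 $ a else G x $ a $ b))"
    by (rule C1_on_det)
  from C1_on_mult[OF this C1_on_inverse[OF C1_on_det[of S G, OF G] det]] show ?thesis
    by (rule C1_on_transform[OF _ S]) (use det in \<open>auto simp: matrix_inv_entry divide_inverse\<close>)
qed

lemma matrix_inv_symmetric:
  fixes B :: "real^'n^'n"
  assumes "transpose B = B" "det B \<noteq> 0"
  shows "matrix_inv B $ i $ j = matrix_inv B $ j $ i"
proof -
  have "transpose (B ** matrix_inv B) = mat 1"
    by (simp add: matrix_inv_right_inverse[OF assms(2)] transpose_mat)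
  then have "transpose (matrix_inv B) ** B = mat 1"
    using assms(1) by (simp add: matrix_transpose_mul)
  then have "B ** transpose (matrix_inv B) = mat 1" using matrix_left_right_inverse by blast
  then have sym: "matrix_inv B = transpose (matrix_inv B)" by (rule matrix_inv_unique)
  show ?thesis by (subst sym) (simp add: transpose_def)
qed

lemma matrix_inv_congruent:
  fixes B C J :: "real^'n^'n"
  assumes "B = transpose J ** C ** J" "det B \<noteq> 0"
  shows "matrix_inv C = J ** matrix_inv B ** transpose J"
proof -
  have "(transpose J ** C) ** (J ** matrix_inv B) = mat 1"
    using matrix_inv_right_inverse[OF assms(2)] assms(1) by (simp add: matrix_mul_assoc)
  then have "(J ** matrix_inv B) ** (transpose J ** C) = mat 1"
    using matrix_left_right_inverse by blast
  then have "(J ** matrix_inv B ** transpose J) ** C = mat 1" by (simp add: matrix_mul_assoc)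
  then have "C ** (J ** matrix_inv B ** transpose J) = mat 1"
    using matrix_left_right_inverse by blast
  then show ?thesis by (rule matrix_inv_unique)
qed

section \<open>Charts and the Riemannian volume\<close>

locale compact_riemannian_space =
  fixes A :: "('m::t2_space, 'n::finite) chart set"
    and g :: "('m, 'n) metric_components"
    and vol :: "'m measure"
  assumes manifold: "compact_riemannian_manifold A g"
    and volume: "riemannian_volume A g vol"
begin

lemma chart_open: "(U, \<phi>) \<in> A \<Longrightarrow> open U" "(U, \<phi>) \<in> A \<Longrightarrow> open (\<phi> ` U)"
  and chart_homeomorphism: "(U, \<phi>) \<in> A \<Longrightarrow> homeomorphism U (\<phi> ` U) \<phi> (inv_into U \<phi>)"
  using manifold unfolding compact_riemannian_manifold_def smooth_atlas_def by blast+

lemma chart_cover: obtains U \<phi> where "(U, \<phi>) \<in> A" "p \<in> U"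
  using manifold unfolding compact_riemannian_manifold_def smooth_atlas_def by blast

lemma transition_smooth:
  "(U, \<phi>) \<in> A \<Longrightarrow> (V, \<psi>) \<in> A \<Longrightarrow> smooth_on (\<phi> ` (U \<inter> V)) (\<psi> \<circ> inv_into U \<phi>)"
  using manifold unfolding compact_riemannian_manifold_def smooth_atlas_def by blast

lemma chart_inverse: "(U, \<phi>) \<in> A \<Longrightarrow> p \<in> U \<Longrightarrow> inv_into U \<phi> (\<phi> p) = p"
  using homeomorphism_apply1[OF chart_homeomorphism] .

lemma chart_continuous: "(U, \<phi>) \<in> A \<Longrightarrow> continuous_on U \<phi>"
  and chart_inverse_continuous: "(U, \<phi>) \<in> A \<Longrightarrow> continuous_on (\<phi> ` U) (inv_into U \<phi>)"
  using chart_homeomorphism unfolding homeomorphism_def by blast+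

lemma chart_image_open:
  assumes c: "(U, \<phi>) \<in> A" and W: "open W" "W \<subseteq> U"
  shows "open (\<phi> ` W)"
proof -
  have "openin (top_of_set U) W" using W by (simp add: openin_open_eq[OF chart_open(1)[OF c]])
  from homeomorphism_imp_open_map[OF chart_homeomorphism[OF c] this] show ?thesis
    using openin_open_trans chart_open(2)[OF c] by blast
qed

lemma chart_preimage_open:
  assumes c: "(U, \<phi>) \<in> A" and W: "open W" "W \<subseteq> \<phi> ` U"
  shows "open (inv_into U \<phi> ` W)"
proof -
  have "openin (top_of_set (\<phi> ` U)) W" using W by (simp add: openin_open_eq[OF chart_open(2)[OF c]])
  from homeomorphism_imp_open_map[OF homeomorphism_symD[OF chart_homeomorphism[OF c]] this] show ?thesis
    using openin_open_trans chart_open(1)[OF c] by blast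
qed

lemma metric_smooth: "(U, \<phi>) \<in> A \<Longrightarrow> smooth_on (\<phi> ` U) (g (U, \<phi>))"
  and metric_symmetric: "(U, \<phi>) \<in> A \<Longrightarrow> x \<in> \<phi> ` U \<Longrightarrow> transpose (g (U, \<phi>) x) = g (U, \<phi>) x"
  and metric_positive: "(U, \<phi>) \<in> A \<Longrightarrow> x \<in> \<phi> ` U \<Longrightarrow> v \<noteq> 0 \<Longrightarrow> v \<bullet> (g (U, \<phi>) x *v v) > 0"
  using manifold unfolding compact_riemannian_manifold_def riemannian_metric_def by blast+

lemma metric_transformation:
  assumes "(U, \<phi>) \<in> A" "(V, \<psi>) \<in> A" "p \<in> U" "p \<in> V"
    and "J = matrix (frechet_derivative (\<psi> \<circ> inv_into U \<phi>) (at (\<phi> p)))"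
  shows "g (U, \<phi>) (\<phi> p) = transpose J ** g (V, \<psi>) (\<psi> p) ** J"
proof -
  have "\<forall>(U, \<phi>)\<in>A. \<forall>(V, \<psi>)\<in>A. \<forall>p\<in>U \<inter> V.
        g (U, \<phi>) (\<phi> p) = transpose (matrix (frechet_derivative (\<psi> \<circ> inv_into U \<phi>) (at (\<phi> p))))
          ** g (V, \<psi>) (\<psi> p) ** matrix (frechet_derivative (\<psi> \<circ> inv_into U \<phi>) (at (\<phi> p)))"
    using manifold unfolding compact_riemannian_manifold_def riemannian_metric_def Let_def by blast
  then show ?thesis using assms by blast
qed

lemma metric_det_pos: "(U, \<phi>) \<in> A \<Longrightarrow> x \<in> \<phi> ` U \<Longrightarrow> det (g (U, \<phi>) x) > 0"
  using positive_definite_imp_det_pos metric_positive by blast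

lemma C1_on_metric: "(U, \<phi>) \<in> A \<Longrightarrow> C1_on (\<phi> ` U) (\<lambda>x. g (U, \<phi>) x $ i $ j)"
  by (intro C1_on_bounded_linear[OF bounded_linear_vec_nth] smooth_on_imp_C1_on[OF metric_smooth])

lemma C1_on_volume_density: "(U, \<phi>) \<in> A \<Longrightarrow> C1_on (\<phi> ` U) (\<lambda>x. sqrt (det (g (U, \<phi>) x)))"
  by (intro C1_on_sqrt C1_on_det C1_on_metric metric_det_pos)

lemma C1_on_inverse_metric: "(U, \<phi>) \<in> A \<Longrightarrow> C1_on (\<phi> ` U) (\<lambda>x. matrix_inv (g (U, \<phi>) x) $ i $ j)"
  by (intro C1_on_matrix_inv C1_on_metric chart_open(2)) (use metric_det_pos in force)+

lemma sets_volume [measurable_cong, simp]: "sets vol = sets borel"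
  using volume unfolding riemannian_volume_def by blast

lemma space_volume [simp]: "space vol = UNIV"
  using sets_eq_imp_space_eq[OF sets_volume] by simp

lemma emeasure_volume:
  assumes "(U, \<phi>) \<in> A" "B \<in> sets borel" "B \<subseteq> U"
  shows "emeasure vol B = (\<integral>\<^sup>+x\<in>\<phi> ` B. ennreal (sqrt (det (g (U, \<phi>) x))) \<partial>lborel)"
  using volume assms unfolding riemannian_volume_def by blast

text \<open>Around each point there is a coordinate ball whose closure still lies in the chart; the
  density is bounded on it, so it has finite volume. Finitely many such balls cover the manifold.\<close>

lemma finite_volume: "finite_measure vol"
proof
  have "\<exists>W. open W \<and> p \<in> W \<and> emeasure vol W < \<infinity>" for p
  proof -
    obtain U \<phi> where c: "(U, \<phi>) \<in> A" "p \<in> U" by (rule chart_cover)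
    let ?d = "\<lambda>x. sqrt (det (g (U, \<phi>) x))"
    obtain r where r: "r > 0" "cball (\<phi> p) r \<subseteq> \<phi> ` U"
      using chart_open(2)[OF c(1)] c(2) open_contains_cball by blast
    let ?W = "inv_into U \<phi> ` ball (\<phi> p) r"
    have sub: "ball (\<phi> p) r \<subseteq> \<phi> ` U" using r(2) ball_subset_cball by blast
    have W: "open ?W" by (rule chart_preimage_open[OF c(1) open_ball sub])
    have WU: "?W \<subseteq> U" using sub by (auto intro: inv_into_into)
    have pW: "p \<in> ?W" 
      using chart_inverse[OF c] r(1) by (intro image_eqI[of _ _ "\<phi> p"]) auto
    have im: "\<phi> ` ?W = ball (\<phi> p) r"
    proof -
      have "\<phi> ` ?W = (\<lambda>x. x) ` ball (\<phi> p) r"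
        unfolding image_image by (rule image_cong[OF refl]) (use sub in \<open>auto simp: f_inv_into_f subset_iff\<close>)
      then show ?thesis by simp
    qed
    have cont: "continuous_on (cball (\<phi> p) r) ?d"
      using continuous_on_subset[OF C1_on_imp_continuous_on[OF C1_on_volume_density[OF c(1)]] r(2)] .
    have "bounded (?d ` cball (\<phi> p) r)"
      by (intro compact_imp_bounded compact_continuous_image cont compact_cball)
    then obtain C where C: "\<And>x. x \<in> cball (\<phi> p) r \<Longrightarrow> norm (?d x) \<le> C" unfolding bounded_iff by blast
    have "emeasure vol ?W = (\<integral>\<^sup>+x\<in>ball (\<phi> p) r. ennreal (?d x) \<partial>lborel)"
      using emeasure_volume[OF c(1) _ WU] W im by simp
    also have "\<dots> \<le> (\<integral>\<^sup>+x. ennreal C * indicator (ball (\<phi> p) r) x \<partial>lborel)"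
    proof (rule nn_integral_mono)
      fix x show "ennreal (?d x) * indicator (ball (\<phi> p) r) x \<le> ennreal C * indicator (ball (\<phi> p) r) x"
        using C[of x] by (cases "x \<in> ball (\<phi> p) r") (auto intro!: ennreal_leI)
    qed
    also have "\<dots> = ennreal C * emeasure lborel (ball (\<phi> p) r)"
      by (simp add: nn_integral_cmult_indicator)
    also have "\<dots> < \<infinity>"
      using emeasure_bounded_finite[OF bounded_ball[of "\<phi> p" r]] by (simp add: ennreal_mult_less_top)
    finally show ?thesis using W pW by blast
  qed
  then obtain W where W: "\<And>p. open (W p)" "\<And>p. p \<in> W p" "\<And>p. emeasure vol (W p) < \<infinity>" by metis
  have "compact (UNIV :: 'm set)" using manifold by (simp add: compact_riemannian_manifold_def)
  then obtain T where T: "finite T" "UNIV \<subseteq> (\<Union>p\<in>T. W p)"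
    by (rule compactE_image[of UNIV UNIV W]) (use W in auto)
  have "emeasure vol UNIV \<le> (\<Sum>p\<in>T. emeasure vol (W p))"
  proof -
    have "(\<Union>p\<in>T. W p) = UNIV" using T(2) by blast
    moreover have "W ` T \<subseteq> sets vol" using W(1) by auto
    ultimately show ?thesis using emeasure_subadditive_finite[OF T(1), of W vol] by simp
  qed
  also have "\<dots> < \<infinity>" using W(3) T(1) by simp
  finally show "emeasure vol (space vol) \<noteq> \<infinity>" by simp
qed

lemma integrable_continuous:
  fixes h :: "'m \<Rightarrow> 'b::{banach, second_countable_topology}"
  assumes h: "continuous_on UNIV h"
  shows "integrable vol h"
proof -
  interpret finite_measure vol by (rule finite_volume)
  have "compact (UNIV :: 'm set)" using manifold by (simp add: compact_riemannian_manifold_def)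
  then have "bounded (range h)" using compact_continuous_image[OF h] compact_imp_bounded by blast
  then obtain C where "\<And>p. norm (h p) \<le> C" unfolding bounded_iff by blast
  then show ?thesis
    by (intro integrable_const_bound[of _ C]) (auto simp: borel_measurable_continuous_onI[OF h] measurable_cong_sets[OF sets_volume refl])
qed

text \<open>The volume restricted to \<open>U\<close> is the image, under the inverse chart, of Lebesgue measure with
  density \<open>sqrt (det g)\<close>.\<close>

lemma integral_in_chart:
  fixes h :: "'m \<Rightarrow> complex"
  assumes c: "(U, \<phi>) \<in> A" and h: "h \<in> borel_measurable borel" and h0: "\<And>p. p \<notin> U \<Longrightarrow> h p = 0"
  shows "(\<integral>p. h p \<partial>vol) =
    (\<integral>x. indicator (\<phi> ` U) x *\<^sub>R (sqrt (det (g (U, \<phi>) x)) *\<^sub>R h (inv_into U \<phi> x)) \<partial>lborel)"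
proof -
  let ?S = "\<phi> ` U"
  define d where "d = (\<lambda>x. indicator ?S x * sqrt (det (g (U, \<phi>) x)))"
  \<comment> \<open>The value of \<open>\<psi>\<close> off the chart image is immaterial, since the density \<open>d\<close> vanishes there.\<close>
  define \<psi> where "\<psi> = (\<lambda>x. if x \<in> ?S then inv_into U \<phi> x else undefined)"
  have S: "?S \<in> sets borel" and U: "U \<in> sets borel" using chart_open[OF c] by auto
  have d_nonneg: "0 \<le> d x" for x
    using metric_det_pos[OF c, of x] by (auto simp: d_def indicator_def)
  have [measurable]: "d \<in> borel_measurable borel"
    unfolding d_def
    using borel_measurable_continuous_on_indicator[OF S C1_on_imp_continuous_on[OF C1_on_volume_density[OF c]]]
    by simp
  have [measurable]: "\<psi> \<in> borel_measurable borel"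
    unfolding \<psi>_def by (rule borel_measurable_continuous_on_if[OF S chart_inverse_continuous[OF c] continuous_on_const])
  have [measurable]: "h \<in> borel_measurable borel" by (rule h)
  have eq: "distr (density lborel (\<lambda>x. ennreal (d x))) borel \<psi> = density vol (\<lambda>p. ennreal (indicator U p))"
    (is "?N = ?M")
  proof (rule measure_eqI)
    show "sets ?N = sets ?M" by simp
    fix B assume "B \<in> sets ?N"
    then have B[measurable]: "B \<in> sets borel" by simp
    have BU: "B \<inter> U \<in> sets borel" using U by simp
    have "emeasure ?N B = (\<integral>\<^sup>+x. ennreal (d x) * indicator (\<psi> -` B) x \<partial>lborel)"
      by (simp add: emeasure_distr emeasure_density measurable_sets_borel[of \<psi> borel])
    also have "\<dots> = (\<integral>\<^sup>+x\<in>\<phi> ` (B \<inter> U). ennreal (sqrt (det (g (U, \<phi>) x))) \<partial>lborel)"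
    proof (rule nn_integral_cong)
      fix x show "ennreal (d x) * indicator (\<psi> -` B) x
        = ennreal (sqrt (det (g (U, \<phi>) x))) * indicator (\<phi> ` (B \<inter> U)) x"
      proof (cases "x \<in> ?S")
        case True
        then obtain p where p: "p \<in> U" "x = \<phi> p" by blast
        then have "\<psi> x = p" by (simp add: \<psi>_def chart_inverse[OF c])
        moreover have "x \<in> \<phi> ` (B \<inter> U) \<longleftrightarrow> p \<in> B"
          using p chart_inverse[OF c] by (metis IntD1 IntD2 IntI image_iff)
        ultimately show ?thesis using True by (simp add: d_def indicator_def)
      qed (auto simp: d_def indicator_def)
    qed
    also have "\<dots> = emeasure vol (B \<inter> U)" using emeasure_volume[OF c BU] by simp
    also have "\<dots> = (\<integral>\<^sup>+p. indicator (B \<inter> U) p \<partial>vol)" using BU by simp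
    also have "\<dots> = (\<integral>\<^sup>+p. ennreal (indicator U p) * indicator B p \<partial>vol)"
      by (rule nn_integral_cong) (auto simp: indicator_def)
    also have "\<dots> = emeasure ?M B" using B U by (subst emeasure_density) auto
    finally show "emeasure ?N B = emeasure ?M B" .
  qed
  have "(\<integral>p. h p \<partial>vol) = (\<integral>p. indicator U p *\<^sub>R h p \<partial>vol)"
    by (rule Bochner_Integration.integral_cong) (use h0 in \<open>auto simp: indicator_def\<close>)
  also have "\<dots> = (\<integral>p. h p \<partial>?M)"
    using U by (subst integral_density) auto
  also have "\<dots> = (\<integral>p. h p \<partial>?N)" by (simp add: eq)
  also have "\<dots> = (\<integral>x. h (\<psi> x) \<partial>density lborel (\<lambda>x. ennreal (d x)))"
    by (rule integral_distr) simp_all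
  also have "\<dots> = (\<integral>x. d x *\<^sub>R h (\<psi> x) \<partial>lborel)"
    by (rule integral_density) (simp_all add: d_nonneg)
  also have "\<dots> = (\<integral>x. indicator ?S x *\<^sub>R (sqrt (det (g (U, \<phi>) x)) *\<^sub>R h (inv_into U \<phi> x)) \<partial>lborel)"
    by (rule Bochner_Integration.integral_cong) (auto simp: d_def \<psi>_def indicator_def)
  finally show ?thesis .
qed

end

section \<open>The pairing of gradients\<close>

lemma linear_expand_axis:
  fixes L :: "real^'n \<Rightarrow> 'c::real_normed_vector"
  assumes "linear L"
  shows "L w = (\<Sum>k\<in>UNIV. (w $ k) *\<^sub>R L (axis k 1))"
proof -
  have "L w = L (\<Sum>k\<in>UNIV. (w $ k) *\<^sub>R axis k 1)"
    using basis_expansion[of w] by (simp add: scalar_mult_eq_scaleR)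
  also have "\<dots> = (\<Sum>k\<in>UNIV. (w $ k) *\<^sub>R L (axis k 1))"
    by (simp add: linear_sum[OF assms] linear_cmul[OF assms])
  finally show ?thesis .
qed

text \<open>If covectors transform by \<open>J\<close>, the Hermitian form with matrix \<open>H\<close> transforms into the one
  with matrix \<open>J H J\<^sup>T\<close>; the proof reorders a fourfold sum.\<close>

lemma pairing_change_of_frame:
  fixes H J :: "real^'n^'n" and a b :: "'n \<Rightarrow> complex"
  shows "(\<Sum>i\<in>UNIV. \<Sum>j\<in>UNIV. H $ i $ j *\<^sub>R ((\<Sum>k\<in>UNIV. J $ k $ j *\<^sub>R a k) * cnj (\<Sum>l\<in>UNIV. J $ l $ i *\<^sub>R b l)))
    = (\<Sum>l\<in>UNIV. \<Sum>k\<in>UNIV. (J ** H ** transpose J) $ l $ k *\<^sub>R (a k * cnj (b l)))"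
proof -
  let ?t = "\<lambda>i j k l. (J $ l $ i * H $ i $ j * J $ k $ j) *\<^sub>R (a k * cnj (b l))"
  have "(\<Sum>i\<in>UNIV. \<Sum>j\<in>UNIV. H $ i $ j *\<^sub>R ((\<Sum>k\<in>UNIV. J $ k $ j *\<^sub>R a k) * cnj (\<Sum>l\<in>UNIV. J $ l $ i *\<^sub>R b l)))
    = (\<Sum>i\<in>UNIV. \<Sum>j\<in>UNIV. \<Sum>k\<in>UNIV. \<Sum>l\<in>UNIV. ?t i j k l)"
    by (simp add: sum_product scaleR_sum_right cnj_sum mult_ac)
  also have "\<dots> = (\<Sum>i\<in>UNIV. \<Sum>k\<in>UNIV. \<Sum>j\<in>UNIV. \<Sum>l\<in>UNIV. ?t i j k l)"
    by (intro sum.cong refl sum.swap)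
  also have "\<dots> = (\<Sum>i\<in>UNIV. \<Sum>k\<in>UNIV. \<Sum>l\<in>UNIV. \<Sum>j\<in>UNIV. ?t i j k l)"
    by (intro sum.cong refl sum.swap)
  also have "\<dots> = (\<Sum>i\<in>UNIV. \<Sum>l\<in>UNIV. \<Sum>k\<in>UNIV. \<Sum>j\<in>UNIV. ?t i j k l)"
    by (intro sum.cong refl sum.swap)
  also have "\<dots> = (\<Sum>l\<in>UNIV. \<Sum>i\<in>UNIV. \<Sum>k\<in>UNIV. \<Sum>j\<in>UNIV. ?t i j k l)"
    by (rule sum.swap)
  also have "\<dots> = (\<Sum>l\<in>UNIV. \<Sum>k\<in>UNIV. \<Sum>i\<in>UNIV. \<Sum>j\<in>UNIV. ?t i j k l)"
    by (intro sum.cong refl sum.swap)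
  also have "\<dots> = (\<Sum>l\<in>UNIV. \<Sum>k\<in>UNIV. \<Sum>j\<in>UNIV. \<Sum>i\<in>UNIV. ?t i j k l)"
    by (intro sum.cong refl sum.swap)
  also have "\<dots> = (\<Sum>l\<in>UNIV. \<Sum>k\<in>UNIV. (J ** H ** transpose J) $ l $ k *\<^sub>R (a k * cnj (b l)))"
    by (simp add: matrix_matrix_mult_def transpose_def scaleR_sum_left sum_distrib_right)
  finally show ?thesis .
qed

context compact_riemannian_space begin

definition C1_fun :: "('m \<Rightarrow> 'b::real_normed_vector) \<Rightarrow> bool" where
  "C1_fun u \<longleftrightarrow> (\<forall>(U, \<phi>)\<in>A. C1_on (\<phi> ` U) (\<lambda>x. u (inv_into U \<phi> x)))"

lemma C1_funD: "C1_fun u \<Longrightarrow> (U, \<phi>) \<in> A \<Longrightarrow> C1_on (\<phi> ` U) (\<lambda>x. u (inv_into U \<phi> x))"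
  unfolding C1_fun_def by blast

lemma C1_funI: "(\<And>U \<phi>. (U, \<phi>) \<in> A \<Longrightarrow> C1_on (\<phi> ` U) (\<lambda>x. u (inv_into U \<phi> x))) \<Longrightarrow> C1_fun u"
  unfolding C1_fun_def by blast

lemma smooth_function_imp_C1_fun: "smooth_function A u \<Longrightarrow> C1_fun u"
  unfolding smooth_function_def by (rule C1_funI) (use smooth_on_imp_C1_on in \<open>fastforce simp: comp_def\<close>)

lemma C1_fun_scaleR:
  fixes b :: "'m \<Rightarrow> real" and u :: "'m \<Rightarrow> 'b::real_normed_vector"
  shows "C1_fun b \<Longrightarrow> C1_fun u \<Longrightarrow> C1_fun (\<lambda>p. b p *\<^sub>R u p)"
  by (intro C1_funI C1_on_scaleR) (auto dest: C1_funD)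

lemma C1_fun_sum:
  fixes u :: "'i \<Rightarrow> 'm \<Rightarrow> 'b::real_normed_vector"
  shows "(\<And>i. i \<in> I \<Longrightarrow> C1_fun (u i)) \<Longrightarrow> C1_fun (\<lambda>p. \<Sum>i\<in>I. u i p)"
  by (intro C1_funI C1_on_sum) (auto dest: C1_funD)

lemma C1_fun_inverse:
  fixes b :: "'m \<Rightarrow> real"
  shows "C1_fun b \<Longrightarrow> (\<And>p. b p \<noteq> 0) \<Longrightarrow> C1_fun (\<lambda>p. inverse (b p))"
  by (intro C1_funI C1_on_inverse) (auto dest: C1_funD)

lemma continuous_if_continuous_in_charts:
  fixes u :: "'m \<Rightarrow> 'b::topological_space"
  assumes "\<And>U \<phi>. (U, \<phi>) \<in> A \<Longrightarrow> continuous_on (\<phi> ` U) (\<lambda>x. u (inv_into U \<phi> x))"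
  shows "continuous_on UNIV u"
proof -
  have "continuous_on (fst c) u" if "c \<in> A" for c
  proof -
    obtain U \<phi> where c: "c = (U, \<phi>)" "(U, \<phi>) \<in> A" using \<open>c \<in> A\<close> by (cases c) auto
    have "continuous_on U (\<lambda>p. u (inv_into U \<phi> (\<phi> p)))"
      by (rule continuous_on_compose2[OF assms[OF c(2)] chart_continuous[OF c(2)]]) auto
    then show ?thesis
      unfolding c fst_conv by (rule continuous_on_eq) (simp add: chart_inverse[OF c(2)])
  qed
  then have "continuous_on (\<Union>c\<in>A. fst c) u"
    by (intro continuous_on_open_UN) (use chart_open(1) in auto)
  moreover have "(\<Union>c\<in>A. fst c) = UNIV" using chart_cover by (metis UNIV_eq_I UN_I fst_conv)
  ultimately show ?thesis by simp
qed

lemma C1_fun_continuous: "C1_fun u \<Longrightarrow> continuous_on UNIV u"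
  by (rule continuous_if_continuous_in_charts) (rule C1_on_imp_continuous_on[OF C1_funD])

text \<open>In the chart \<open>(U, \<phi>)\<close> this is the Riemannian inner product of the gradients of \<open>u\<close> and \<open>w\<close>,
  conjugate-linear in \<open>w\<close>, at the point with coordinates \<open>x\<close>.\<close>

definition chart_pairing ::
    "'m set \<Rightarrow> ('m \<Rightarrow> real^'n) \<Rightarrow> ('m \<Rightarrow> complex) \<Rightarrow> ('m \<Rightarrow> complex) \<Rightarrow> real^'n \<Rightarrow> complex" where
  "chart_pairing U \<phi> u w x = (\<Sum>i\<in>UNIV. \<Sum>j\<in>UNIV. matrix_inv (g (U, \<phi>) x) $ i $ j *\<^sub>R
     (partial_deriv j (\<lambda>y. u (inv_into U \<phi> y)) x * cnj (partial_deriv i (\<lambda>y. w (inv_into U \<phi> y)) x)))"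

lemma partial_deriv_change_of_chart:
  assumes c: "(U, \<phi>) \<in> A" "(V, \<psi>) \<in> A" "p \<in> U" "p \<in> V" and u: "C1_fun u"
  shows "partial_deriv j (\<lambda>y. u (inv_into U \<phi> y)) (\<phi> p) =
    (\<Sum>k\<in>UNIV. matrix (frechet_derivative (\<psi> \<circ> inv_into U \<phi>) (at (\<phi> p))) $ k $ j *\<^sub>R
       partial_deriv k (\<lambda>y. u (inv_into V \<psi> y)) (\<psi> p))"
proof -
  let ?T = "\<psi> \<circ> inv_into U \<phi>" and ?uV = "\<lambda>y. u (inv_into V \<psi> y)"
  let ?O = "\<phi> ` (U \<inter> V)"
  let ?DT = "frechet_derivative ?T (at (\<phi> p))" and ?Du = "frechet_derivative ?uV (at (\<psi> p))"
  have O: "open ?O" by (rule chart_image_open[OF c(1)]) (use chart_open(1) c in auto)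
  have T: "(?T has_derivative ?DT) (at (\<phi> p))"
    by (rule C1_on_has_derivative[OF smooth_on_imp_C1_on[OF transition_smooth[OF c(1,2)]]]) (use c in auto)
  have Tp: "?T (\<phi> p) = \<psi> p" by (simp add: chart_inverse[OF c(1,3)])
  have D: "(?uV has_derivative ?Du) (at (?T (\<phi> p)))"
    unfolding Tp by (rule C1_on_has_derivative[OF C1_funD[OF u c(2)]]) (use c in auto)
  have "((\<lambda>y. ?uV (?T y)) has_derivative (\<lambda>v. ?Du (?DT v))) (at (\<phi> p))"
    by (rule has_derivative_compose[OF T D])
  then have "((\<lambda>y. u (inv_into U \<phi> y)) has_derivative (\<lambda>v. ?Du (?DT v))) (at (\<phi> p))"
    by (rule has_derivative_transform_within_open[OF _ O])
      (use c in \<open>auto simp: chart_inverse[OF c(1)] chart_inverse[OF c(2)]\<close>)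
  from frechet_derivative_at[OF this, symmetric]
  have "partial_deriv j (\<lambda>y. u (inv_into U \<phi> y)) (\<phi> p) = ?Du (?DT (axis j 1))"
    by (simp add: partial_deriv_def)
  also have "\<dots> = (\<Sum>k\<in>UNIV. ?DT (axis j 1) $ k *\<^sub>R ?Du (axis k 1))"
    by (rule linear_expand_axis[OF has_derivative_linear[OF D]])
  finally show ?thesis by (simp add: partial_deriv_def matrix_def)
qed

text \<open>The transformation law of the metric under the Jacobian \<open>J\<close> of a transition map makes the
  inverse metric transform by \<open>J\<close> and \<open>J\<^sup>T\<close>, and this compensates the chain rule for the partial
  derivatives. Only first derivatives enter here, which makes this much simpler than the invariance of
  the Laplacian itself.\<close>

lemma chart_pairing_invariant:
  assumes c: "(U, \<phi>) \<in> A" "(V, \<psi>) \<in> A" "p \<in> U" "p \<in> V" and u: "C1_fun u" and w: "C1_fun w"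
  shows "chart_pairing U \<phi> u w (\<phi> p) = chart_pairing V \<psi> u w (\<psi> p)"
proof -
  define J where "J = matrix (frechet_derivative (\<psi> \<circ> inv_into U \<phi>) (at (\<phi> p)))"
  have "det (g (U, \<phi>) (\<phi> p)) \<noteq> 0" using metric_det_pos[OF c(1)] c(3) by force
  from matrix_inv_congruent[OF metric_transformation[OF c J_def] this]
  have "matrix_inv (g (V, \<psi>) (\<psi> p)) = J ** matrix_inv (g (U, \<phi>) (\<phi> p)) ** transpose J" .
  then show ?thesis
    unfolding chart_pairing_def partial_deriv_change_of_chart[OF c u]
      partial_deriv_change_of_chart[OF c w] J_def[symmetric] pairing_change_of_frame by simp
qed

text \<open>The chart is an arbitrary one around \<open>p\<close>; by invariance the choice does not matter for
  \<open>C\<^sup>1\<close> functions.\<close>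

definition grad_pairing :: "('m \<Rightarrow> complex) \<Rightarrow> ('m \<Rightarrow> complex) \<Rightarrow> 'm \<Rightarrow> complex" where
  "grad_pairing u w p = (let (U, \<phi>) = (SOME c. c \<in> A \<and> p \<in> fst c) in chart_pairing U \<phi> u w (\<phi> p))"

lemma grad_pairing_in_chart:
  assumes c: "(U, \<phi>) \<in> A" "p \<in> U" and u: "C1_fun u" and w: "C1_fun w"
  shows "grad_pairing u w p = chart_pairing U \<phi> u w (\<phi> p)"
proof -
  obtain V \<psi> where V: "(SOME c. c \<in> A \<and> p \<in> fst c) = (V, \<psi>)" by (meson surj_pair)
  have "(SOME c. c \<in> A \<and> p \<in> fst c) \<in> A \<and> p \<in> fst (SOME c. c \<in> A \<and> p \<in> fst c)"
    by (rule someI[where P="\<lambda>c. c \<in> A \<and> p \<in> fst c"]) (use c in auto)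
  then have "(V, \<psi>) \<in> A" "p \<in> V" using V by auto
  from chart_pairing_invariant[OF c(1) this(1) c(2) this(2) u w] show ?thesis
    by (simp add: grad_pairing_def V)
qed

lemma grad_pairing_hermitian:
  assumes u: "C1_fun u" and w: "C1_fun w"
  shows "grad_pairing w u p = cnj (grad_pairing u w p)"
proof -
  obtain U \<phi> where c: "(U, \<phi>) \<in> A" "p \<in> U" by (rule chart_cover)
  let ?H = "matrix_inv (g (U, \<phi>) (\<phi> p))"
  have sym: "?H $ i $ j = ?H $ j $ i" for i j
    by (rule matrix_inv_symmetric) (use metric_symmetric[OF c(1)] metric_det_pos[OF c(1)] c(2) in force)+
  show ?thesis
    unfolding grad_pairing_in_chart[OF c u w] grad_pairing_in_chart[OF c w u] chart_pairing_def
    apply (subst sum.swap)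
    unfolding cnj_sum
    by (intro sum.cong refl) (subst sym, simp add: mult.commute)
qed

lemma grad_pairing_continuous:
  assumes u: "C1_fun u" and w: "C1_fun w"
  shows "continuous_on UNIV (grad_pairing u w)"
proof (rule continuous_if_continuous_in_charts)
  fix U \<phi> assume c: "(U, \<phi>) \<in> A"
  have "continuous_on (\<phi> ` U) (chart_pairing U \<phi> u w)"
    unfolding chart_pairing_def[abs_def] partial_deriv_def
    by (intro continuous_intros C1_on_imp_continuous_on[OF C1_on_inverse_metric[OF c]]
        C1_on_continuous_derivative C1_funD u w c)
  then show "continuous_on (\<phi> ` U) (\<lambda>x. grad_pairing u w (inv_into U \<phi> x))"
    by (rule continuous_on_eq) (auto simp: chart_inverse[OF c] grad_pairing_in_chart[OF c _ u w])
qed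

lemma partial_deriv_sum:
  assumes "finite T" "\<And>t. t \<in> T \<Longrightarrow> C1_on S (f t)" "x \<in> S"
  shows "partial_deriv i (\<lambda>y. \<Sum>t\<in>T. f t y) x = (\<Sum>t\<in>T. partial_deriv i (f t) x)"
proof -
  have "((\<lambda>y. \<Sum>t\<in>T. f t y) has_derivative (\<lambda>v. \<Sum>t\<in>T. frechet_derivative (f t) (at x) v)) (at x)"
    by (intro has_derivative_sum C1_on_has_derivative[OF assms(2) assms(3)])
  from frechet_derivative_at[OF this, symmetric] show ?thesis by (simp add: partial_deriv_def)
qed

lemma grad_pairing_sum:
  assumes T: "finite T" and u: "C1_fun u" and w: "\<And>t. t \<in> T \<Longrightarrow> C1_fun (w t)"
  shows "grad_pairing u (\<lambda>p. \<Sum>t\<in>T. w t p) p = (\<Sum>t\<in>T. grad_pairing u (w t) p)"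
proof -
  obtain U \<phi> where c: "(U, \<phi>) \<in> A" "p \<in> U" by (rule chart_cover)
  have d: "partial_deriv i (\<lambda>y. \<Sum>t\<in>T. w t (inv_into U \<phi> y)) (\<phi> p)
     = (\<Sum>t\<in>T. partial_deriv i (\<lambda>y. w t (inv_into U \<phi> y)) (\<phi> p))" for i
    by (rule partial_deriv_sum[OF T C1_funD[OF w c(1)]]) (use c in auto)
  let ?H = "matrix_inv (g (U, \<phi>) (\<phi> p))"
  let ?t = "\<lambda>i j t. ?H $ i $ j *\<^sub>R (partial_deriv j (\<lambda>y. u (inv_into U \<phi> y)) (\<phi> p)
      * cnj (partial_deriv i (\<lambda>y. w t (inv_into U \<phi> y)) (\<phi> p)))"
  have sw: "C1_fun (\<lambda>p. \<Sum>t\<in>T. w t p)" by (rule C1_fun_sum) (rule w)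
  have "grad_pairing u (\<lambda>p. \<Sum>t\<in>T. w t p) p = (\<Sum>i\<in>UNIV. \<Sum>j\<in>UNIV. \<Sum>t\<in>T. ?t i j t)"
    unfolding grad_pairing_in_chart[OF c u sw] chart_pairing_def d
    by (simp add: cnj_sum sum_distrib_left scaleR_sum_right)
  also have "\<dots> = (\<Sum>i\<in>UNIV. \<Sum>t\<in>T. \<Sum>j\<in>UNIV. ?t i j t)" by (intro sum.cong refl sum.swap)
  also have "\<dots> = (\<Sum>t\<in>T. \<Sum>i\<in>UNIV. \<Sum>j\<in>UNIV. ?t i j t)" by (rule sum.swap)
  also have "\<dots> = (\<Sum>t\<in>T. grad_pairing u (w t) p)"
    by (intro sum.cong refl) (simp add: grad_pairing_in_chart[OF c u w] chart_pairing_def)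
  finally show ?thesis .
qed

section \<open>Green's identity and orthogonality of eigenspaces\<close>

text \<open>A cut-off function written in one chart and extended by zero is \<open>C\<^sup>1\<close> in every chart: its
  support \<open>K\<close> is compact, hence closed, so each chart is covered by the open sets where it either
  overlaps \<open>U\<close> or avoids \<open>K\<close>.\<close>

lemma bump_exists:
  obtains U \<phi> b K where "(U, \<phi>) \<in> A" "compact K" "K \<subseteq> U" "C1_fun (b :: 'm \<Rightarrow> real)"
    "\<And>q. 0 \<le> b q" "0 < b p" "\<And>q. q \<notin> K \<Longrightarrow> b q = 0"
proof -
  obtain U \<phi> where c: "(U, \<phi>) \<in> A" "p \<in> U" by (rule chart_cover)
  obtain r where r: "r > 0" "cball (\<phi> p) r \<subseteq> \<phi> ` U"
    using chart_open(2)[OF c(1)] c(2) open_contains_cball by blast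
  define \<beta> :: "real^'n \<Rightarrow> real" where "\<beta> = (\<lambda>x. (max 0 (r\<^sup>2 - (norm (x - \<phi> p))\<^sup>2))\<^sup>2)"
  define b where "b q = (if q \<in> U then \<beta> (\<phi> q) else 0)" for q
  define K where "K = inv_into U \<phi> ` cball (\<phi> p) r"
  have K: "compact K"
    unfolding K_def
    by (rule compact_continuous_image[OF continuous_on_subset[OF chart_inverse_continuous[OF c(1)] r(2)] compact_cball])
  have KU: "K \<subseteq> U" unfolding K_def using r(2) by (auto intro: inv_into_into)
  have b0: "b q = 0" if "q \<notin> K" for q
  proof (cases "q \<in> U")
    case True
    then have "\<phi> q \<notin> cball (\<phi> p) r"
      using that chart_inverse[OF c(1) True] unfolding K_def by (metis image_eqI)
    then have "r\<^sup>2 \<le> (norm (\<phi> q - \<phi> p))\<^sup>2"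
      using r(1) by (intro power_mono) (auto simp: dist_norm norm_minus_commute)
    then show ?thesis by (simp add: b_def \<beta>_def)
  qed (simp add: b_def)
  have "C1_fun b"
  proof (rule C1_funI)
    fix V \<psi> assume V: "(V, \<psi>) \<in> A"
    have o1: "open (\<psi> ` (V \<inter> U))"
      by (rule chart_image_open[OF V]) (use chart_open(1) V c in auto)
    have o2: "open (\<psi> ` (V - K))"
      by (rule chart_image_open[OF V]) (use chart_open(1)[OF V] compact_imp_closed[OF K] in auto)
    have "C1_on (\<psi> ` (V \<inter> U)) (\<lambda>x. \<beta> ((\<phi> \<circ> inv_into V \<psi>) x))"
      by (rule C1_on_compose[OF smooth_on_imp_C1_on[OF transition_smooth[OF V c(1)]], where R=UNIV])
        (simp_all add: \<beta>_def C1_on_bump)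
    then have 1: "C1_on (\<psi> ` (V \<inter> U)) (\<lambda>x. b (inv_into V \<psi> x))"
      by (rule C1_on_transform[OF _ o1]) (auto simp: b_def chart_inverse[OF V])
    have "C1_on (\<psi> ` (V - K)) (\<lambda>x. 0::real)" by simp
    then have 2: "C1_on (\<psi> ` (V - K)) (\<lambda>x. b (inv_into V \<psi> x))"
      by (rule C1_on_transform[OF _ o2]) (auto simp: b0 chart_inverse[OF V])
    have "\<psi> ` (V \<inter> U) \<union> \<psi> ` (V - K) = \<psi> ` V" using KU by blast
    then show "C1_on (\<psi> ` V) (\<lambda>x. b (inv_into V \<psi> x))" using C1_on_open_Un[OF o1 o2 1 2] by simp
  qed
  moreover have "0 < b p" using c(2) r(1) by (simp add: b_def \<beta>_def)
  ultimately show ?thesis using that[OF c(1) K KU, of b] b0 by (auto simp: b_def \<beta>_def)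
qed

text \<open>For \<open>w\<close> supported in one chart the factor \<open>sqrt (det g)\<close> of the volume cancels the
  denominator of the Laplacian. What remains is a Euclidean divergence times \<open>cnj w\<close>, which is
  integrated by parts.\<close>

lemma green_in_chart:
  assumes lap: "has_laplacian A g u Lu" and Lu: "continuous_on UNIV Lu"
    and w: "C1_fun w" and c: "(U, \<phi>) \<in> A" and K: "compact K" "K \<subseteq> U" "\<And>q. q \<notin> K \<Longrightarrow> w q = 0"
  shows "(\<integral>p. Lu p * cnj (w p) \<partial>vol) = - (\<integral>p. grad_pairing u w p \<partial>vol)"
proof -
  let ?S = "\<phi> ` U" and ?G = "g (U, \<phi>)"
  let ?d = "\<lambda>x. sqrt (det (?G x))"
  define uc where "uc = (\<lambda>y. u (inv_into U \<phi> y))"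
  define wc where "wc = (\<lambda>y. w (inv_into U \<phi> y))"
  have smooth_u: "smooth_function A u" using lap by (simp add: has_laplacian_def)
  have u: "C1_fun u" by (rule smooth_function_imp_C1_fun[OF smooth_u])
  have uc: "smooth_on ?S uc"
    using smooth_u c unfolding smooth_function_def uc_def comp_def by blast
  have wc: "C1_on ?S wc" unfolding wc_def by (rule C1_funD[OF w c])
  have S: "open ?S" by (rule chart_open(2)[OF c])
  \<comment> \<open>The components of the gradient of \<open>u\<close>, weighted by the volume density.\<close>
  define F where "F i y = (\<Sum>j\<in>UNIV. (?d y * matrix_inv (?G y) $ i $ j) *\<^sub>R partial_deriv j uc y)" for i y
  have F: "C1_on ?S (F i)" for i
    unfolding F_def partial_deriv_def
    by (intro C1_on_sum C1_on_scaleR C1_on_mult C1_on_volume_density C1_on_inverse_metric c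
        smooth_on_imp_C1_on_derivative uc)
  let ?K = "\<phi> ` K"
  have Kc: "compact ?K" "?K \<subseteq> ?S"
    using compact_continuous_image[OF continuous_on_subset[OF chart_continuous[OF c] K(2)] K(1)] K(2) by auto
  have w0: "cnj (wc x) = 0" if x: "x \<in> ?S" "x \<notin> ?K" for x
  proof -
    obtain p where p: "p \<in> U" "x = \<phi> p" using x(1) by blast
    then have "p \<notin> K" using x(2) by blast
    then show ?thesis using p K(3) by (simp add: wc_def chart_inverse[OF c])
  qed
  note ibp = integration_by_parts_compact_support[OF S F C1_on_cnj[OF wc] Kc w0, where v="axis _ 1"]
  have dcnj: "frechet_derivative (\<lambda>x. cnj (wc x)) (at x) v = cnj (frechet_derivative wc (at x) v)"
    if "x \<in> ?S" for x v
    using frechet_derivative_at[OF bounded_linear.has_derivative[OF bounded_linear_cnj C1_on_has_derivative[OF wc that]]]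
    by metis
  have lapc: "?d x *\<^sub>R Lu (inv_into U \<phi> x) = (\<Sum>i\<in>UNIV. frechet_derivative (F i) (at x) (axis i 1))"
    if x: "x \<in> ?S" for x
  proof -
    obtain p where p: "p \<in> U" "x = \<phi> p" using x by blast
    have "local_laplacian ?G uc x = Lu (inv_into U \<phi> x)"
      using lap c p unfolding has_laplacian_def uc_def by (auto simp: comp_def chart_inverse[OF c])
    moreover have "local_laplacian ?G uc x = (1 / ?d x) *\<^sub>R (\<Sum>i\<in>UNIV. frechet_derivative (F i) (at x) (axis i 1))"
      unfolding local_laplacian_def F_def partial_deriv_def ..
    ultimately have "Lu (inv_into U \<phi> x) = (1 / ?d x) *\<^sub>R (\<Sum>i\<in>UNIV. frechet_derivative (F i) (at x) (axis i 1))"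
      by (rule trans[OF sym])
    then show ?thesis using metric_det_pos[OF c x] by simp
  qed
  have pairc: "(\<Sum>i\<in>UNIV. F i x * frechet_derivative (\<lambda>x. cnj (wc x)) (at x) (axis i 1))
      = ?d x *\<^sub>R grad_pairing u w (inv_into U \<phi> x)" if x: "x \<in> ?S" for x
  proof -
    obtain p where p: "p \<in> U" "x = \<phi> p" using x by blast
    have "grad_pairing u w (inv_into U \<phi> x) = chart_pairing U \<phi> u w x"
      using grad_pairing_in_chart[OF c p(1) u w] p chart_inverse[OF c p(1)] by simp
    then show ?thesis
      by (simp add: chart_pairing_def F_def dcnj[OF x] partial_deriv_def uc_def[symmetric] wc_def[symmetric]
          scaleR_sum_right sum_distrib_right)
  qed
  have contLw: "continuous_on UNIV (\<lambda>p. Lu p * cnj (w p))"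
    by (intro continuous_intros Lu C1_fun_continuous w)
  have gp0: "grad_pairing u w p = 0" if "p \<notin> U" for p
  proof -
    obtain V \<psi> where V: "(V, \<psi>) \<in> A" "p \<in> V" by (rule chart_cover)
    have "((\<lambda>_. 0) has_derivative (\<lambda>_. 0)) (at (\<psi> p))" by simp
    then have "((\<lambda>y. w (inv_into V \<psi> y)) has_derivative (\<lambda>_. 0)) (at (\<psi> p))"
    proof (rule has_derivative_transform_within_open)
      show "open (\<psi> ` (V - K))"
        by (rule chart_image_open[OF V(1)]) (use chart_open(1)[OF V(1)] compact_imp_closed[OF K(1)] in auto)
    qed (use V K that in \<open>auto simp: chart_inverse[OF V(1)]\<close>)
    from frechet_derivative_at[OF this, symmetric]
    show ?thesis by (simp add: grad_pairing_in_chart[OF V u w] chart_pairing_def partial_deriv_def)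
  qed
  have "(\<integral>p. Lu p * cnj (w p) \<partial>vol)
     = (\<integral>x. indicator ?S x *\<^sub>R (?d x *\<^sub>R (Lu (inv_into U \<phi> x) * cnj (w (inv_into U \<phi> x)))) \<partial>lborel)"
    using K by (intro integral_in_chart[OF c] borel_measurable_continuous_onI contLw) auto
  also have "\<dots> = (\<integral>x. (\<Sum>i\<in>UNIV. indicator ?S x *\<^sub>R (frechet_derivative (F i) (at x) (axis i 1) * cnj (wc x))) \<partial>lborel)"
    by (rule Bochner_Integration.integral_cong)
      (auto simp: indicator_def lapc[symmetric] wc_def sum_distrib_right[symmetric])
  also have "\<dots> = (\<Sum>i\<in>UNIV. \<integral>x. indicator ?S x *\<^sub>R (frechet_derivative (F i) (at x) (axis i 1) * cnj (wc x)) \<partial>lborel)"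
    by (rule Bochner_Integration.integral_sum) (rule ibp(1))
  also have "\<dots> = (\<Sum>i\<in>UNIV. - (\<integral>x. indicator ?S x *\<^sub>R (F i x * frechet_derivative (\<lambda>x. cnj (wc x)) (at x) (axis i 1)) \<partial>lborel))"
    by (rule sum.cong[OF refl]) (rule ibp(3))
  also have "\<dots> = - (\<integral>x. (\<Sum>i\<in>UNIV. indicator ?S x *\<^sub>R (F i x * frechet_derivative (\<lambda>x. cnj (wc x)) (at x) (axis i 1))) \<partial>lborel)"
    unfolding sum_negf
    by (rule arg_cong[of _ _ uminus], rule Bochner_Integration.integral_sum[symmetric], rule ibp(2))
  also have "\<dots> = - (\<integral>x. indicator ?S x *\<^sub>R (?d x *\<^sub>R grad_pairing u w (inv_into U \<phi> x)) \<partial>lborel)"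
    by (intro arg_cong[of _ _ uminus] Bochner_Integration.integral_cong) (auto simp: indicator_def pairc)
  also have "\<dots> = - (\<integral>p. grad_pairing u w p \<partial>vol)"
    by (intro arg_cong[of _ _ uminus] integral_in_chart[OF c, symmetric]
        borel_measurable_continuous_onI grad_pairing_continuous u w gp0)
  finally show ?thesis .
qed

text \<open>Finitely many cut-offs \<open>b p\<close> have a sum \<open>s\<close> that is positive everywhere. The pieces
  \<open>b p v / s\<close> of \<open>v\<close> live in single charts and add up to \<open>v\<close>. Green's
  identity for \<open>v\<close> is the sum of those for the pieces, which enter through their first
  derivatives alone; this is why \<open>C\<^sup>1\<close> cut-offs suffice.\<close>

lemma green:
  assumes lap: "has_laplacian A g u Lu" and Lu: "continuous_on UNIV Lu" and v: "C1_fun v"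
  shows "(\<integral>p. Lu p * cnj (v p) \<partial>vol) = - (\<integral>p. grad_pairing u v p \<partial>vol)"
proof -
  have u: "C1_fun u" using lap by (intro smooth_function_imp_C1_fun) (simp add: has_laplacian_def)
  have "\<forall>p. \<exists>b :: 'm \<Rightarrow> real. C1_fun b \<and> (\<forall>q. 0 \<le> b q) \<and> 0 < b p \<and>
      (\<exists>U \<phi> K. (U, \<phi>) \<in> A \<and> compact K \<and> K \<subseteq> U \<and> (\<forall>q. q \<notin> K \<longrightarrow> b q = 0))"
  proof
    fix p
    show "\<exists>b :: 'm \<Rightarrow> real. C1_fun b \<and> (\<forall>q. 0 \<le> b q) \<and> 0 < b p \<and>
      (\<exists>U \<phi> K. (U, \<phi>) \<in> A \<and> compact K \<and> K \<subseteq> U \<and> (\<forall>q. q \<notin> K \<longrightarrow> b q = 0))"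
      by (rule bump_exists[of p]) blast
  qed
  then obtain b :: "'m \<Rightarrow> 'm \<Rightarrow> real" where b: "\<And>p. C1_fun (b p)" "\<And>p q. 0 \<le> b p q" "\<And>p. 0 < b p p"
    and supp: "\<And>p. \<exists>U \<phi> K. (U, \<phi>) \<in> A \<and> compact K \<and> K \<subseteq> U \<and> (\<forall>q. q \<notin> K \<longrightarrow> b p q = 0)"
    by metis
  have "compact (UNIV :: 'm set)" using manifold by (simp add: compact_riemannian_manifold_def)
  moreover have "open {q. 0 < b p q}" for p
    by (intro open_Collect_less continuous_on_const C1_fun_continuous b)
  ultimately obtain T where T: "finite T" "UNIV \<subseteq> (\<Union>p\<in>T. {q. 0 < b p q})"
    by (rule compactE_image[of UNIV UNIV "\<lambda>p. {q. 0 < b p q}"]) (use b(3) in \<open>auto intro: exI[of _ "_ :: 'm"]\<close>)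
  define s where "s q = (\<Sum>p\<in>T. b p q)" for q
  have s_pos: "s q > 0" for q
  proof -
    obtain p where "p \<in> T" "0 < b p q" using T(2) by blast
    then show ?thesis unfolding s_def using T(1) b(2) by (intro sum_pos2[of T p]) auto
  qed
  define w where "w p q = b p q *\<^sub>R (inverse (s q) *\<^sub>R v q)" for p q
  have "C1_fun (\<lambda>q. inverse (s q))"
    using s_pos by (intro C1_fun_inverse) (auto simp: s_def[abs_def] less_le intro!: C1_fun_sum b)
  then have w: "C1_fun (w p)" for p
    unfolding w_def[abs_def] by (intro C1_fun_scaleR b v)
  have v_eq: "v q = (\<Sum>p\<in>T. w p q)" for q
  proof -
    have "(\<Sum>p\<in>T. w p q) = s q *\<^sub>R (inverse (s q) *\<^sub>R v q)"
      unfolding w_def s_def by (rule scaleR_sum_left[symmetric])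
    then show ?thesis using s_pos[of q] by simp
  qed
  have loc: "(\<integral>q. Lu q * cnj (w p q) \<partial>vol) = - (\<integral>q. grad_pairing u (w p) q \<partial>vol)" for p
    using supp[of p] green_in_chart[OF lap Lu w] by (auto simp: w_def)
  have "(\<integral>q. Lu q * cnj (v q) \<partial>vol) = (\<integral>q. (\<Sum>p\<in>T. Lu q * cnj (w p q)) \<partial>vol)"
    by (simp add: v_eq cnj_sum sum_distrib_left)
  also have "\<dots> = (\<Sum>p\<in>T. \<integral>q. Lu q * cnj (w p q) \<partial>vol)"
    by (intro Bochner_Integration.integral_sum integrable_continuous continuous_intros Lu C1_fun_continuous w)
  also have "\<dots> = - (\<Sum>p\<in>T. \<integral>q. grad_pairing u (w p) q \<partial>vol)" by (simp add: loc sum_negf)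
  also have "\<dots> = - (\<integral>q. (\<Sum>p\<in>T. grad_pairing u (w p) q) \<partial>vol)"
    by (subst Bochner_Integration.integral_sum) (auto intro!: integrable_continuous grad_pairing_continuous u w)
  also have "\<dots> = - (\<integral>q. grad_pairing u v q \<partial>vol)"
    using v_eq by (simp add: grad_pairing_sum[OF T(1) u w, symmetric] v_eq[symmetric])
  finally show ?thesis .
qed

lemma eigenspace_C1_fun: "u \<in> laplace_eigenspace A g \<nu> \<Longrightarrow> C1_fun u"
  by (auto simp: laplace_eigenspace_def has_laplacian_def intro: smooth_function_imp_C1_fun)

text \<open>Since the pairing of gradients is Hermitian, Green's identity gives
  \<open>\<nu> \<langle>u, v\<rangle> = \<kappa> \<langle>u, v\<rangle>\<close> for real eigenvalues \<open>\<nu>\<close> and \<open>\<kappa>\<close>.\<close>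

lemma eigenspaces_orthogonal:
  assumes u: "u \<in> laplace_eigenspace A g \<nu>" and v: "v \<in> laplace_eigenspace A g \<kappa>" and ne: "\<nu> \<noteq> \<kappa>"
  shows "L2_inner vol u v = 0"
proof -
  note Cu = eigenspace_C1_fun[OF u] and Cv = eigenspace_C1_fun[OF v]
  have cont: "continuous_on UNIV u" "continuous_on UNIV v" using Cu Cv C1_fun_continuous by auto
  have "(\<integral>p. (\<nu> *\<^sub>R u p) * cnj (v p) \<partial>vol) = - (\<integral>p. grad_pairing u v p \<partial>vol)"
    using u by (intro green continuous_intros cont Cv) (simp add: laplace_eigenspace_def)
  then have 1: "\<nu> *\<^sub>R L2_inner vol u v = - (\<integral>p. grad_pairing u v p \<partial>vol)"
    by (simp add: L2_inner_def)
  have "(\<integral>p. (\<kappa> *\<^sub>R v p) * cnj (u p) \<partial>vol) = - (\<integral>p. grad_pairing v u p \<partial>vol)"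
    using v by (intro green continuous_intros cont Cu) (simp add: laplace_eigenspace_def)
  then have "\<kappa> *\<^sub>R L2_inner vol v u = - (\<integral>p. cnj (grad_pairing u v p) \<partial>vol)"
    by (simp add: L2_inner_def grad_pairing_hermitian[OF Cu Cv])
  moreover have "L2_inner vol v u = cnj (L2_inner vol u v)"
  proof -
    have "L2_inner vol v u = (\<integral>p. cnj (u p * cnj (v p)) \<partial>vol)"
      by (simp add: L2_inner_def mult.commute del: Bochner_Integration.integral_cnj)
    then show ?thesis by (simp only: L2_inner_def Bochner_Integration.integral_cnj)
  qed
  ultimately have "cnj (\<kappa> *\<^sub>R L2_inner vol u v) = cnj (- (\<integral>p. grad_pairing u v p \<partial>vol))"
    by simp
  with 1 have "\<nu> *\<^sub>R L2_inner vol u v = \<kappa> *\<^sub>R L2_inner vol u v" by (metis complex_cnj_cancel_iff)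
  then show ?thesis using ne by simp
qed

end

section \<open>Square-integrable functions\<close>

lemma L2_product_integrable:
  assumes "f \<in> L2_space M" "h \<in> L2_space M"
  shows "integrable M (\<lambda>x. f x * cnj (h x))"
proof (rule Bochner_Integration.integrable_bound)
  show "integrable M (\<lambda>x. (cmod (f x))\<^sup>2 + (cmod (h x))\<^sup>2)"
    using assms by (intro Bochner_Integration.integrable_add) (auto simp: L2_space_def)
  have "f \<in> borel_measurable M" "h \<in> borel_measurable M" using assms by (auto simp: L2_space_def)
  moreover from this(2) have "(\<lambda>x. cnj (h x)) \<in> borel_measurable M"
    by (rule borel_measurable_continuous_on[rotated]) (intro continuous_intros)
  ultimately show "(\<lambda>x. f x * cnj (h x)) \<in> borel_measurable M" by (intro borel_measurable_times)
  have "a * b \<le> a\<^sup>2 + b\<^sup>2" if "0 \<le> a" "0 \<le> b" for a b :: real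
  proof -
    have "a * b \<le> 2 * a * b" using that by simp
    then show ?thesis using sum_squares_bound[of a b] by linarith
  qed
  then show "AE x in M. norm (f x * cnj (h x)) \<le> norm ((cmod (f x))\<^sup>2 + (cmod (h x))\<^sup>2)"
    by (intro AE_I2) (simp add: norm_mult)
qed

lemma L2_space_add:
  assumes "f \<in> L2_space M" "h \<in> L2_space M"
  shows "(\<lambda>x. f x + h x) \<in> L2_space M"
proof -
  have m: "f \<in> borel_measurable M" "h \<in> borel_measurable M" using assms by (auto simp: L2_space_def)
  have "integrable M (\<lambda>x. (cmod (f x + h x))\<^sup>2)"
  proof (rule Bochner_Integration.integrable_bound)
    show "integrable M (\<lambda>x. 2 * (cmod (f x))\<^sup>2 + 2 * (cmod (h x))\<^sup>2)"
      using assms by (intro Bochner_Integration.integrable_add integrable_mult_right) (auto simp: L2_space_def)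
    show "(\<lambda>x. (cmod (f x + h x))\<^sup>2) \<in> borel_measurable M"
      using m by measurable
    have "(cmod (f x + h x))\<^sup>2 \<le> 2 * (cmod (f x))\<^sup>2 + 2 * (cmod (h x))\<^sup>2" for x
    proof -
      have "(cmod (f x + h x))\<^sup>2 \<le> (cmod (f x) + cmod (h x))\<^sup>2"
        by (intro power_mono norm_triangle_ineq norm_ge_zero)
      also have "\<dots> \<le> 2 * (cmod (f x))\<^sup>2 + 2 * (cmod (h x))\<^sup>2"
        using sum_squares_bound[of "cmod (f x)" "cmod (h x)"] by (simp add: power2_sum)
      finally show ?thesis .
    qed
    then show "AE x in M. norm ((cmod (f x + h x))\<^sup>2) \<le> norm (2 * (cmod (f x))\<^sup>2 + 2 * (cmod (h x))\<^sup>2)"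
      by (intro AE_I2) simp
  qed
  then show ?thesis using m by (simp add: L2_space_def)
qed

lemma L2_space_mult: "f \<in> L2_space M \<Longrightarrow> (\<lambda>x. c * f x) \<in> L2_space M"
  by (auto simp: L2_space_def norm_mult power_mult_distrib)

lemma L2_space_diff: "f \<in> L2_space M \<Longrightarrow> h \<in> L2_space M \<Longrightarrow> (\<lambda>x. f x - h x) \<in> L2_space M"
  using L2_space_add[of f M "\<lambda>x. (- 1) * h x"] L2_space_mult[of h M "- 1"] by simp

lemma L2_space_zero: "(\<lambda>_. 0) \<in> L2_space M" by (simp add: L2_space_def)

lemma L2_space_sum: "(\<And>t. t \<in> T \<Longrightarrow> h t \<in> L2_space M) \<Longrightarrow> (\<lambda>x. \<Sum>t\<in>T. h t x) \<in> L2_space M"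
  by (induction T rule: infinite_finite_induct) (auto intro: L2_space_add L2_space_zero)

lemma L2_inner_commute: "L2_inner M h f = cnj (L2_inner M f h)"
proof -
  have "L2_inner M h f = (\<integral>x. cnj (f x * cnj (h x)) \<partial>M)"
    by (simp add: L2_inner_def mult.commute del: Bochner_Integration.integral_cnj)
  then show ?thesis by (simp only: L2_inner_def Bochner_Integration.integral_cnj)
qed

lemma L2_inner_diff_left:
  "f \<in> L2_space M \<Longrightarrow> h \<in> L2_space M \<Longrightarrow> q \<in> L2_space M \<Longrightarrow>
    L2_inner M (\<lambda>x. f x - h x) q = L2_inner M f q - L2_inner M h q"
  by (simp add: L2_inner_def left_diff_distrib L2_product_integrable)

lemma L2_inner_diff_right:
  "f \<in> L2_space M \<Longrightarrow> h \<in> L2_space M \<Longrightarrow> q \<in> L2_space M \<Longrightarrow>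
    L2_inner M q (\<lambda>x. f x - h x) = L2_inner M q f - L2_inner M q h"
  by (simp add: L2_inner_commute[of M q] L2_inner_diff_left)

lemma L2_inner_mult_left: "L2_inner M (\<lambda>x. c * f x) h = c * L2_inner M f h"
  by (simp add: L2_inner_def mult.assoc)

lemma L2_inner_mult_right: "L2_inner M f (\<lambda>x. c * h x) = cnj c * L2_inner M f h"
  by (simp add: L2_inner_commute[of M f] L2_inner_mult_left)

lemma L2_inner_sum_left:
  "(\<And>t. t \<in> T \<Longrightarrow> h t \<in> L2_space M) \<Longrightarrow> q \<in> L2_space M \<Longrightarrow>
    L2_inner M (\<lambda>x. \<Sum>t\<in>T. h t x) q = (\<Sum>t\<in>T. L2_inner M (h t) q)"
  by (simp add: L2_inner_def sum_distrib_right L2_product_integrable)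

lemma L2_inner_sum_right:
  "(\<And>t. t \<in> T \<Longrightarrow> h t \<in> L2_space M) \<Longrightarrow> q \<in> L2_space M \<Longrightarrow>
    L2_inner M q (\<lambda>x. \<Sum>t\<in>T. h t x) = (\<Sum>t\<in>T. L2_inner M q (h t))"
  by (simp add: L2_inner_commute[of M q] L2_inner_sum_left cnj_sum)

lemma L2_norm_nonneg: "0 \<le> L2_norm M f"
  by (simp add: L2_norm_def)

lemma L2_inner_self: "L2_inner M f f = of_real ((L2_norm M f)\<^sup>2)"
proof -
  have "(L2_norm M f)\<^sup>2 = (\<integral>x. (cmod (f x))\<^sup>2 \<partial>M)"
    by (simp add: L2_norm_def)
  moreover have "f x * cnj (f x) = of_real ((cmod (f x))\<^sup>2)" for x
    by (rule complex_norm_square[symmetric])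
  ultimately show ?thesis by (simp only: L2_inner_def integral_complex_of_real)
qed

lemma L2_norm_eq_0_iff:
  assumes "f \<in> L2_space M"
  shows "L2_norm M f = 0 \<longleftrightarrow> (AE x in M. f x = 0)"
proof -
  have "(\<integral>x. (cmod (f x))\<^sup>2 \<partial>M) = 0 \<longleftrightarrow> (AE x in M. (cmod (f x))\<^sup>2 = 0)"
    using assms by (intro integral_nonneg_eq_0_iff_AE) (auto simp: L2_space_def)
  then show ?thesis by (simp add: L2_norm_def)
qed

lemma L2_inner_zero_norm_right:
  assumes "r \<in> L2_space M" "L2_norm M r = 0"
  shows "L2_inner M f r = 0"
proof -
  have "AE x in M. f x * cnj (r x) = 0"
    using L2_norm_eq_0_iff[OF assms(1)] assms(2) by auto
  then show ?thesis unfolding L2_inner_def by (rule integral_eq_zero_AE)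
qed

text \<open>The difference of the two sides is the squared distance from \<open>q\<close> to the sum of the \<open>h t\<close>:
  orthogonality of each remainder \<open>q - h t\<close> to \<open>h t\<close> gives \<open>\<langle>q, h t\<rangle> = \<parallel>h t\<parallel>\<^sup>2\<close>.\<close>

lemma L2_bessel:
  assumes T: "finite T" and q: "q \<in> L2_space M" and h: "\<And>t. t \<in> T \<Longrightarrow> h t \<in> L2_space M"
    and proj: "\<And>t. t \<in> T \<Longrightarrow> L2_inner M (\<lambda>x. q x - h t x) (h t) = 0"
    and orth: "\<And>s t. s \<in> T \<Longrightarrow> t \<in> T \<Longrightarrow> s \<noteq> t \<Longrightarrow> L2_inner M (h s) (h t) = 0"
  shows "(\<Sum>t\<in>T. (L2_norm M (h t))\<^sup>2) \<le> (L2_norm M q)\<^sup>2"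
proof -
  define s where "s = (\<lambda>x. \<Sum>t\<in>T. h t x)"
  let ?B = "\<Sum>t\<in>T. (L2_norm M (h t))\<^sup>2"
  have s: "s \<in> L2_space M" unfolding s_def by (rule L2_space_sum) (rule h)
  have qh: "L2_inner M q (h t) = of_real ((L2_norm M (h t))\<^sup>2)" if "t \<in> T" for t
    using proj[OF that] L2_inner_diff_left[OF q h[OF that] h[OF that]] by (simp add: L2_inner_self)
  have qs: "L2_inner M q s = of_real ?B"
    unfolding s_def using h q by (simp add: L2_inner_sum_right qh)
  have "L2_inner M (h t) s = of_real ((L2_norm M (h t))\<^sup>2)" if "t \<in> T" for t
  proof -
    have "L2_inner M (h t) s = (\<Sum>t'\<in>T. L2_inner M (h t) (h t'))"
      unfolding s_def using h that by (simp add: L2_inner_sum_right)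
    also have "\<dots> = (\<Sum>t'\<in>T. if t' = t then L2_inner M (h t) (h t) else 0)"
      by (intro sum.cong refl) (use orth that in auto)
    finally show ?thesis using T that by (simp add: L2_inner_self)
  qed
  then have "(\<Sum>t\<in>T. L2_inner M (h t) s) = of_real ?B" by simp
  then have ss: "L2_inner M s s = of_real ?B"
    using L2_inner_sum_left[of T h M s] h s unfolding s_def by simp
  have "of_real ((L2_norm M (\<lambda>x. q x - s x))\<^sup>2) = L2_inner M (\<lambda>x. q x - s x) (\<lambda>x. q x - s x)"
    by (rule L2_inner_self[symmetric])
  also have "\<dots> = of_real ((L2_norm M q)\<^sup>2) - cnj (of_real ?B) - (of_real ?B - of_real ?B)"
    using q s by (simp add: L2_inner_diff_left L2_inner_diff_right L2_space_diff L2_inner_self[of M q] ss qs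
        L2_inner_commute[of M s q])
  also have "\<dots> = complex_of_real ((L2_norm M q)\<^sup>2 - ?B)" by simp
  finally have "(L2_norm M (\<lambda>x. q x - s x))\<^sup>2 = (L2_norm M q)\<^sup>2 - ?B" by (simp only: of_real_eq_iff)
  then show ?thesis using zero_le_power2[of "L2_norm M (\<lambda>x. q x - s x)"] by linarith
qed

text \<open>A function orthogonal to every \<open>e j\<close> is by Pythagoras at distance at least its own norm from
  each finite combination of the \<open>e j\<close>, so density forces its norm to be zero.\<close>

lemma L2_orthonormal_basis_total:
  assumes e: "L2_orthonormal_basis M e" and r: "r \<in> L2_space M"
    and orth: "\<And>j. L2_inner M r (e j) = 0"
  shows "L2_norm M r = 0"
proof (rule ccontr)
  assume "L2_norm M r \<noteq> 0"
  then have "L2_norm M r > 0" using L2_norm_nonneg[of M r] by simp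
  then obtain n c where nc: "L2_norm M (\<lambda>x. r x - (\<Sum>j<n. c j * e j x)) < L2_norm M r"
    using e r unfolding L2_orthonormal_basis_def by blast
  define s where "s = (\<lambda>x. \<Sum>j<n. c j * e j x)"
  have ce: "(\<lambda>x. c j * e j x) \<in> L2_space M" for j
    using e by (intro L2_space_mult) (simp add: L2_orthonormal_basis_def)
  have s: "s \<in> L2_space M" unfolding s_def by (rule L2_space_sum) (rule ce)
  have "L2_inner M s r = (\<Sum>j<n. c j * L2_inner M (e j) r)"
    unfolding s_def by (simp add: L2_inner_sum_left ce r L2_inner_mult_left)
  then have sr: "L2_inner M s r = 0" using orth by (simp add: L2_inner_commute[of M _ r])
  have "of_real ((L2_norm M (\<lambda>x. r x - s x))\<^sup>2) = L2_inner M (\<lambda>x. r x - s x) (\<lambda>x. r x - s x)"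
    by (rule L2_inner_self[symmetric])
  also have "\<dots> = complex_of_real ((L2_norm M r)\<^sup>2 + (L2_norm M s)\<^sup>2)"
    using r s sr by (simp add: L2_inner_diff_left L2_inner_diff_right L2_space_diff L2_inner_self[of M r]
        L2_inner_self[of M s] L2_inner_commute[of M r s])
  finally have "(L2_norm M (\<lambda>x. r x - s x))\<^sup>2 = (L2_norm M r)\<^sup>2 + (L2_norm M s)\<^sup>2"
    by (simp only: of_real_eq_iff)
  then have "(L2_norm M r)\<^sup>2 \<le> (L2_norm M (\<lambda>x. r x - s x))\<^sup>2" by simp
  then have "L2_norm M r \<le> L2_norm M (\<lambda>x. r x - s x)" by (rule power2_le_imp_le) (rule L2_norm_nonneg)
  then show False using nc by (simp add: s_def)
qed

section \<open>Eigenspaces are linear subspaces\<close>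

text \<open>Local congruence for \<open>Ck_on\<close>: derivatives at a point see only the values of a function nearby.
  It is what lets the induction for linear combinations replace a derivative by its formula, which
  holds on \<open>S\<close> only.\<close>

lemma Ck_on_transform:
  assumes "open S"
  shows "Ck_on k S f \<Longrightarrow> (\<And>x. x \<in> S \<Longrightarrow> f x = h x) \<Longrightarrow> Ck_on k S h"
proof (induction k arbitrary: f h)
  case 0
  then show ?case by (auto intro: continuous_on_eq)
next
  case (Suc k)
  have d: "(h has_derivative frechet_derivative f (at x)) (at x)" if "x \<in> S" for x
    using Suc.prems that assms
    by (intro has_derivative_transform_within_open[of f _ x UNIV S h]) (auto simp: frechet_derivative_works)
  have eq: "frechet_derivative f (at x) = frechet_derivative h (at x)" if "x \<in> S" for x
    by (rule frechet_derivative_at[OF d[OF that]])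
  have "Ck_on k S (\<lambda>x. frechet_derivative h (at x) v)" for v
  proof (rule Suc.IH)
    show "Ck_on k S (\<lambda>x. frechet_derivative f (at x) v)" using Suc.prems by simp
  qed (simp add: eq)
  then show ?case using d by (auto simp: differentiable_def)
qed

lemma Ck_on_linear_combination:
  fixes f h :: "'a::real_normed_vector \<Rightarrow> complex"
  assumes "open S"
  shows "Ck_on k S f \<Longrightarrow> Ck_on k S h \<Longrightarrow> Ck_on k S (\<lambda>x. a * f x + b * h x)"
proof (induction k arbitrary: f h)
  case 0
  then show ?case by (auto intro!: continuous_intros)
next
  case (Suc k)
  have d: "((\<lambda>x. a * f x + b * h x) has_derivative
      (\<lambda>v. a * frechet_derivative f (at x) v + b * frechet_derivative h (at x) v)) (at x)" if "x \<in> S" for x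
    using Suc.prems that
    by (intro has_derivative_add has_derivative_mult_right) (auto simp: frechet_derivative_works)
  have "Ck_on k S (\<lambda>x. frechet_derivative (\<lambda>x. a * f x + b * h x) (at x) v)" for v
  proof (rule Ck_on_transform[OF assms])
    show "Ck_on k S (\<lambda>x. a * frechet_derivative f (at x) v + b * frechet_derivative h (at x) v)"
      using Suc.prems by (intro Suc.IH) auto
  qed (simp add: frechet_derivative_at[OF d, symmetric])
  then show ?case using d by (auto simp: differentiable_def)
qed

context compact_riemannian_space begin

text \<open>The Laplacian is written with the Frechet derivative operator, which is additive only where
  the derivatives exist. Smoothness of \<open>u\<close> and \<open>w\<close> provides this for the inner partial derivatives,
  and \<open>C\<^sup>1\<close> coefficients and first derivatives provide it for the outer ones.\<close>

lemma eigenspace_linear_combination: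
  assumes u: "u \<in> laplace_eigenspace A g \<nu>" and w: "w \<in> laplace_eigenspace A g \<nu>"
  shows "(\<lambda>p. a * u p + b * w p) \<in> laplace_eigenspace A g \<nu>"
  unfolding laplace_eigenspace_def has_laplacian_def
proof (intro CollectI conjI ballI)
  have su: "smooth_function A u" and sw: "smooth_function A w"
    using u w by (auto simp: laplace_eigenspace_def has_laplacian_def)
  show "smooth_function A (\<lambda>p. a * u p + b * w p)"
    unfolding smooth_function_def smooth_on_def
  proof (clarify)
    fix U \<phi> k assume c: "(U, \<phi>) \<in> A"
    show "Ck_on k (\<phi> ` U) ((\<lambda>p. a * u p + b * w p) \<circ> inv_into U \<phi>)"
      using su sw c Ck_on_linear_combination[OF chart_open(2)[OF c], of k "u \<circ> inv_into U \<phi>" "w \<circ> inv_into U \<phi>" a b]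
      unfolding smooth_function_def smooth_on_def comp_def by blast
  qed
  fix c assume "c \<in> A"
  show "case c of (U, \<phi>) \<Rightarrow> \<forall>p\<in>U. local_laplacian (g (U, \<phi>)) ((\<lambda>p. a * u p + b * w p) \<circ> inv_into U \<phi>) (\<phi> p)
      = \<nu> *\<^sub>R (a * u p + b * w p)"
  proof (clarify, cases c, clarify)
    fix U \<phi> p assume "c = (U, \<phi>)" and p: "p \<in> U"
    then have c: "(U, \<phi>) \<in> A" using \<open>c \<in> A\<close> by simp
    let ?S = "\<phi> ` U" and ?G = "g (U, \<phi>)"
    have S: "open ?S" by (rule chart_open(2)[OF c])
    have x: "\<phi> p \<in> ?S" using p by simp
    define F where "F v i y = (\<Sum>j\<in>UNIV. (sqrt (det (?G y)) * matrix_inv (?G y) $ i $ j) *\<^sub>R partial_deriv j v y)" for v i y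
    have lap: "local_laplacian ?G v y = (1 / sqrt (det (?G y))) *\<^sub>R (\<Sum>i\<in>UNIV. partial_deriv i (F v i) y)" for v y
      unfolding local_laplacian_def F_def ..
    let ?u = "u \<circ> inv_into U \<phi>" and ?w = "w \<circ> inv_into U \<phi>"
    let ?z = "(\<lambda>p. a * u p + b * w p) \<circ> inv_into U \<phi>"
    have z: "?z = (\<lambda>y. a * ?u y + b * ?w y)" by (simp add: comp_def)
    have sm: "smooth_on ?S ?u" "smooth_on ?S ?w"
      using su sw c unfolding smooth_function_def by blast+
    have F_C1: "C1_on ?S (F v i)" if "smooth_on ?S v" for v i
      unfolding F_def partial_deriv_def
      by (intro C1_on_sum C1_on_scaleR C1_on_mult C1_on_volume_density C1_on_inverse_metric c
          smooth_on_imp_C1_on_derivative that)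
    have lin: "partial_deriv i (\<lambda>y. a * v y + b * q y) y = a * partial_deriv i v y + b * partial_deriv i q y"
      if "C1_on ?S v" "C1_on ?S q" "y \<in> ?S" for v q i y
    proof -
      have "((\<lambda>y. a * v y + b * q y) has_derivative
          (\<lambda>t. a * frechet_derivative v (at y) t + b * frechet_derivative q (at y) t)) (at y)"
        by (intro has_derivative_add has_derivative_mult_right C1_on_has_derivative[OF that(1) that(3)]
            C1_on_has_derivative[OF that(2) that(3)])
      from frechet_derivative_at[OF this, symmetric] show ?thesis by (simp add: partial_deriv_def)
    qed
    have Fz: "F ?z i y = a * F ?u i y + b * F ?w i y" if "y \<in> ?S" for i y
      unfolding F_def z lin[OF smooth_on_imp_C1_on[OF sm(1)] smooth_on_imp_C1_on[OF sm(2)] that]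
      by (simp add: scaleR_add_right sum.distrib sum_distrib_left)
    have "partial_deriv i (F ?z i) (\<phi> p) = partial_deriv i (\<lambda>y. a * F ?u i y + b * F ?w i y) (\<phi> p)" for i
    proof -
      have "((\<lambda>y. a * F ?u i y + b * F ?w i y) has_derivative
          frechet_derivative (\<lambda>y. a * F ?u i y + b * F ?w i y) (at (\<phi> p))) (at (\<phi> p))"
        by (rule C1_on_has_derivative[OF _ x]) (intro C1_on_add C1_on_mult C1_on_const F_C1 sm)
      then have "(F ?z i has_derivative
          frechet_derivative (\<lambda>y. a * F ?u i y + b * F ?w i y) (at (\<phi> p))) (at (\<phi> p))"
        by (rule has_derivative_transform_within_open[OF _ S x]) (rule Fz[symmetric])
      from frechet_derivative_at[OF this] show ?thesis by (simp add: partial_deriv_def)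
    qed
    then have "local_laplacian ?G ?z (\<phi> p)
        = a * local_laplacian ?G ?u (\<phi> p) + b * local_laplacian ?G ?w (\<phi> p)"
      unfolding lap using lin[OF F_C1[OF sm(1)] F_C1[OF sm(2)] x]
      by (simp add: sum.distrib sum_distrib_left scaleR_add_right)
    moreover have "local_laplacian ?G ?u (\<phi> p) = \<nu> *\<^sub>R u p" "local_laplacian ?G ?w (\<phi> p) = \<nu> *\<^sub>R w p"
      using u w c p unfolding laplace_eigenspace_def has_laplacian_def by blast+
    ultimately show "local_laplacian ?G ?z (\<phi> p) = \<nu> *\<^sub>R (a * u p + b * w p)"
      by (simp add: scaleR_add_right)
  qed
qed

lemma eigenspace_sum:
  assumes "finite T" "T \<noteq> {}" "\<And>t. t \<in> T \<Longrightarrow> u t \<in> laplace_eigenspace A g \<nu>"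
  shows "(\<lambda>p. \<Sum>t\<in>T. c t * u t p) \<in> laplace_eigenspace A g \<nu>"
  using assms
proof (induction T rule: finite_ne_induct)
  case (singleton t)
  then show ?case using eigenspace_linear_combination[of "u t" \<nu> "u t" "c t" 0] by simp
next
  case (insert t T)
  then show ?case
    using eigenspace_linear_combination[of "u t" \<nu> "\<lambda>p. \<Sum>t\<in>T. c t * u t p" "c t" 1] by simp
qed

lemma eigenspace_L2:
  assumes "u \<in> laplace_eigenspace A g \<nu>"
  shows "u \<in> L2_space vol"
proof -
  have cont: "continuous_on UNIV u" by (rule C1_fun_continuous[OF eigenspace_C1_fun[OF assms]])
  have "integrable vol (\<lambda>p. (cmod (u p))\<^sup>2)" by (intro integrable_continuous continuous_intros cont)
  then show ?thesis
    by (simp add: L2_space_def measurable_cong_sets[OF sets_volume refl] borel_measurable_continuous_onI[OF cont])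
qed

end

section \<open>Spectral projections and the Fourier ratio\<close>

context compact_riemannian_space begin

text \<open>The difference of two projections of \<open>f\<close> lies in the eigenspace and is orthogonal to it. So
  the norm of an \<open>L\<^sup>2\<close> projection is independent of the representative that is chosen for it.\<close>

lemma spectral_projection_norm_unique:
  assumes f: "f \<in> L2_space vol"
    and h: "is_spectral_projection A g vol \<mu> f h" and h': "is_spectral_projection A g vol \<mu> f h'"
  shows "L2_norm vol h = L2_norm vol h'"
proof -
  define d where "d = (\<lambda>p. h p - h' p)"
  have hE: "h \<in> laplace_eigenspace A g (- \<mu>\<^sup>2)" "h' \<in> laplace_eigenspace A g (- \<mu>\<^sup>2)"
    using h h' by (auto simp: is_spectral_projection_def orthogonal_projection_def)
  have dE: "d \<in> laplace_eigenspace A g (- \<mu>\<^sup>2)"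
    using eigenspace_linear_combination[OF hE, of 1 "-1"] by (simp add: d_def)
  note L2 = eigenspace_L2[OF hE(1)] eigenspace_L2[OF hE(2)] eigenspace_L2[OF dE]
  have "L2_inner vol (\<lambda>p. f p - h p) d = 0" "L2_inner vol (\<lambda>p. f p - h' p) d = 0"
    using h h' dE by (auto simp: is_spectral_projection_def orthogonal_projection_def)
  then have "L2_inner vol h d = L2_inner vol h' d"
    using f L2 by (simp add: L2_inner_diff_left)
  then have "L2_inner vol d d = 0"
    using L2_inner_diff_left[OF L2(1) L2(2) L2(3)] by (simp add: d_def)
  then have "L2_norm vol d = 0" by (simp add: L2_inner_self)
  then have "AE p in vol. h p = h' p" using L2_norm_eq_0_iff[OF L2(3)] by (simp add: d_def)
  moreover have "(\<lambda>p. (cmod (h p))\<^sup>2) \<in> borel_measurable vol" "(\<lambda>p. (cmod (h' p))\<^sup>2) \<in> borel_measurable vol"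
    using L2 by (auto simp: L2_space_def)
  ultimately show ?thesis
    unfolding L2_norm_def by (intro arg_cong[of _ _ sqrt] integral_cong_AE) auto
qed

text \<open>The projection is \<open>\<Sum> \<langle>f, e j\<rangle> e j\<close> over the finitely many \<open>j\<close> with \<open>lam j = \<mu>\<close>. That these
  \<open>e j\<close> span the whole eigenspace is where orthogonality of eigenspaces enters: an eigenfunction
  minus its projection is orthogonal to all basis elements, hence zero almost everywhere.\<close>

lemma spectral_projection_exists:
  assumes basis: "laplace_eigenbasis A g vol e lam" and f: "f \<in> L2_space vol"
    and fin: "finite {j. lam j = \<mu>}" and \<mu>: "\<mu> \<in> range lam"
  shows "\<exists>h. is_spectral_projection A g vol \<mu> f h"
proof -
  let ?E = "laplace_eigenspace A g (- \<mu>\<^sup>2)"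
  define J where "J = {j. lam j = \<mu>}"
  have J: "finite J" "J \<noteq> {}" using fin \<mu> by (auto simp: J_def)
  have onb: "L2_orthonormal_basis vol e" and lam0: "\<And>j. 0 \<le> lam j"
    and eE: "\<And>j. e j \<in> laplace_eigenspace A g (- (lam j)\<^sup>2)"
    using basis by (auto simp: laplace_eigenbasis_def)
  have eL2: "e j \<in> L2_space vol" for j by (rule eigenspace_L2[OF eE])
  have ee: "L2_inner vol (e i) (e j) = (if i = j then 1 else 0)" for i j
    using onb by (simp add: L2_orthonormal_basis_def)
  have eJ: "e j \<in> ?E" if "j \<in> J" for j using eE[of j] that by (simp add: J_def)
  define pr where "pr q p = (\<Sum>j\<in>J. L2_inner vol q (e j) * e j p)" for q p
  have prE: "pr q \<in> ?E" for q
    unfolding pr_def[abs_def] by (rule eigenspace_sum[OF J eJ])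
  have prL2: "pr q \<in> L2_space vol" for q by (rule eigenspace_L2[OF prE])
  have pre: "L2_inner vol (pr q) (e i) = (if i \<in> J then L2_inner vol q (e i) else 0)" for q i
  proof -
    have "L2_inner vol (pr q) (e i) = (\<Sum>j\<in>J. L2_inner vol q (e j) * L2_inner vol (e j) (e i))"
      unfolding pr_def by (simp add: L2_inner_sum_left L2_space_mult eL2 L2_inner_mult_left)
    also have "\<dots> = (\<Sum>j\<in>J. if j = i then L2_inner vol q (e i) else 0)"
      by (intro sum.cong) (auto simp: ee)
    finally show ?thesis using J by simp
  qed
  have "L2_inner vol (\<lambda>p. f p - pr f p) v = 0" if v: "v \<in> ?E" for v
  proof -
    have vL2: "v \<in> L2_space vol" by (rule eigenspace_L2[OF v])
    let ?r = "\<lambda>p. v p - pr v p"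
    have "L2_inner vol ?r (e i) = 0" for i
    proof (cases "i \<in> J")
      case False
      then have "- \<mu>\<^sup>2 \<noteq> - (lam i)\<^sup>2" using lam0 \<mu> by (auto simp: J_def power2_eq_iff_nonneg)
      from eigenspaces_orthogonal[OF v eE this] show ?thesis
        using False by (simp add: L2_inner_diff_left vL2 prL2 eL2 pre)
    qed (simp add: L2_inner_diff_left vL2 prL2 eL2 pre)
    then have "L2_norm vol ?r = 0"
      by (intro L2_orthonormal_basis_total[OF onb] L2_space_diff vL2 prL2)
    then have "L2_inner vol (\<lambda>p. f p - pr f p) ?r = 0"
      by (intro L2_inner_zero_norm_right L2_space_diff vL2 prL2)
    then have "L2_inner vol (\<lambda>p. f p - pr f p) v = L2_inner vol (\<lambda>p. f p - pr f p) (pr v)"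
      by (simp add: L2_inner_diff_right vL2 prL2 L2_space_diff f)
    also have "\<dots> = (\<Sum>j\<in>J. cnj (L2_inner vol v (e j)) * L2_inner vol (\<lambda>p. f p - pr f p) (e j))"
      unfolding pr_def[of v]
      by (simp add: L2_inner_sum_right L2_space_mult eL2 L2_space_diff f prL2 L2_inner_mult_right)
    also have "\<dots> = 0"
      by (intro sum.neutral) (simp add: L2_inner_diff_left f prL2 eL2 pre)
    finally show ?thesis .
  qed
  then show ?thesis
    using prE unfolding is_spectral_projection_def orthogonal_projection_def by blast
qed

text \<open>Bessel's inequality bounds the sum of the squared norms, and Cauchy--Schwarz turns this into
  a bound on the sum of the norms.\<close>

lemma sum_projection_norms_le:
  assumes T: "finite T" "\<And>\<mu>. \<mu> \<in> T \<Longrightarrow> 0 \<le> \<mu>" and q: "q \<in> L2_space vol"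
    and proj: "\<And>\<mu>. \<mu> \<in> T \<Longrightarrow> is_spectral_projection A g vol \<mu> q (h \<mu>)"
  shows "(\<Sum>\<mu>\<in>T. L2_norm vol (h \<mu>)) \<le> sqrt (real (card T)) * L2_norm vol q"
proof -
  have hE: "h \<mu> \<in> laplace_eigenspace A g (- \<mu>\<^sup>2)" if "\<mu> \<in> T" for \<mu>
    using proj[OF that] by (simp add: is_spectral_projection_def orthogonal_projection_def)
  have "(\<Sum>\<mu>\<in>T. (L2_norm vol (h \<mu>))\<^sup>2) \<le> (L2_norm vol q)\<^sup>2"
  proof (rule L2_bessel[OF T(1) q])
    show "h \<mu> \<in> L2_space vol" if "\<mu> \<in> T" for \<mu> by (rule eigenspace_L2[OF hE[OF that]])
    show "L2_inner vol (\<lambda>p. q p - h \<mu> p) (h \<mu>) = 0" if "\<mu> \<in> T" for \<mu>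
      using proj[OF that] by (simp add: is_spectral_projection_def orthogonal_projection_def)
    show "L2_inner vol (h \<mu>) (h \<mu>') = 0" if "\<mu> \<in> T" "\<mu>' \<in> T" "\<mu> \<noteq> \<mu>'" for \<mu> \<mu>'
      by (rule eigenspaces_orthogonal[OF hE hE]) (use that T(2) in \<open>auto simp: power2_eq_iff_nonneg\<close>)
  qed
  then have "(\<Sum>\<mu>\<in>T. (L2_norm vol (h \<mu>))\<^sup>2) * real (card T) \<le> (L2_norm vol q)\<^sup>2 * real (card T)"
    by (intro mult_right_mono) auto
  with sum_squared_le_sum_of_squares[of "\<lambda>\<mu>. L2_norm vol (h \<mu>)" T]
  have "(\<Sum>\<mu>\<in>T. L2_norm vol (h \<mu>))\<^sup>2 \<le> (sqrt (real (card T)) * L2_norm vol q)\<^sup>2"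
    by (simp add: power_mult_distrib mult.commute)
  then show ?thesis by (rule power2_le_imp_le) (simp add: L2_norm_nonneg)
qed

text \<open>At most \<open>k\<close> spectral parameters belong to eigenspaces that contribute to \<open>P\<close>; call their set
  \<open>S\<close>. For every other parameter \<open>P\<close> is orthogonal to the eigenspace, so the projection of \<open>f\<close> is
  also that of \<open>f - P\<close>. Applying \<open>sum_projection_norms_le\<close> to \<open>f\<close> on \<open>S\<close> and to \<open>f - P\<close> off \<open>S\<close> gives the
  two terms.\<close>

lemma fourier_l1_norm_bound:
  assumes basis: "laplace_eigenbasis A g vol e lam" and f: "f \<in> L2_space vol"
    and band: "band_limited A g vol lam \<Lambda> f" and fin: "finite {j. lam j \<le> \<Lambda>}"
    and P: "eigenfunction_combination A g k P"
  shows "fourier_l1_norm A g vol lam f \<le> ennreal (sqrt (real k) * L2_norm vol f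
    + sqrt (real (card {j. lam j \<le> \<Lambda>})) * L2_norm vol (\<lambda>p. f p - P p))"
proof -
  define T where "T = lam ` {j. lam j \<le> \<Lambda>}"
  have T: "finite T" "card T \<le> card {j. lam j \<le> \<Lambda>}"
    using fin by (simp_all add: T_def card_image_le)
  have T_nonneg: "0 \<le> \<mu>" if "\<mu> \<in> T" for \<mu>
    using that basis by (auto simp: T_def laplace_eigenbasis_def)
  define h where "h \<mu> = spectral_projection A g vol \<mu> f" for \<mu>
  have h: "is_spectral_projection A g vol \<mu> f (h \<mu>)" if "\<exists>h. is_spectral_projection A g vol \<mu> f h" for \<mu>
    unfolding h_def spectral_projection_def by (rule someI_ex[OF that])
  have hT: "is_spectral_projection A g vol \<mu> f (h \<mu>)" if "\<mu> \<in> T" for \<mu>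
  proof (rule h, rule spectral_projection_exists[OF basis f])
    show "finite {j. lam j = \<mu>}" by (rule finite_subset[OF _ fin]) (use that in \<open>auto simp: T_def\<close>)
    show "\<mu> \<in> range lam" using that by (auto simp: T_def)
  qed
  have h0: "L2_norm vol (h \<mu>) = 0" if "\<mu> \<in> range lam" "\<mu> \<notin> T" for \<mu>
  proof -
    have "\<mu> > \<Lambda>" using that by (force simp: T_def)
    then have z: "is_spectral_projection A g vol \<mu> f (\<lambda>_. 0)" 
      using band that(1) unfolding band_limited_def by blast
    then have "L2_norm vol (h \<mu>) = L2_norm vol (\<lambda>_. 0)"
      by (intro spectral_projection_norm_unique[OF f h z]) (use z in blast)
    then show ?thesis by (simp add: L2_norm_def)
  qed
  have "fourier_l1_norm A g vol lam f = (\<Sum>\<^sub>\<infinity>\<mu>\<in>T. ennreal (L2_norm vol (h \<mu>)))"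
    unfolding fourier_l1_norm_def h_def[symmetric]
    by (rule infsum_cong_neutral) (use h0 in \<open>auto simp: T_def\<close>)
  also have "\<dots> = ennreal (\<Sum>\<mu>\<in>T. L2_norm vol (h \<mu>))"
    using T(1) by (simp add: sum_ennreal L2_norm_nonneg)
  finally have l1: "fourier_l1_norm A g vol lam f = ennreal (\<Sum>\<mu>\<in>T. L2_norm vol (h \<mu>))" .
  obtain c u where u: "\<And>i. i < k \<Longrightarrow> laplace_eigenfunction A g (u i)" and P_eq: "P = (\<lambda>x. \<Sum>i<k. c i * u i x)"
    using P unfolding eigenfunction_combination_def by blast
  then obtain \<nu> where \<nu>: "\<And>i. i < k \<Longrightarrow> u i \<in> laplace_eigenspace A g (\<nu> i)"
    unfolding laplace_eigenfunction_def by metis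
  have cuL2: "(\<lambda>x. c i * u i x) \<in> L2_space vol" if "i < k" for i
    by (rule L2_space_mult[OF eigenspace_L2[OF \<nu>[OF that]]])
  have PL2: "P \<in> L2_space vol" unfolding P_eq by (rule L2_space_sum) (simp add: cuL2)
  \<comment> \<open>Distinct parameters have distinct eigenvalues because all of them are nonnegative.\<close>
  define S where "S = {\<mu> \<in> T. \<exists>i<k. \<nu> i = - \<mu>\<^sup>2}"
  have "S \<subseteq> (\<lambda>i. sqrt (- \<nu> i)) ` {..<k}"
  proof
    fix \<mu> assume "\<mu> \<in> S"
    then obtain i where "i < k" "\<nu> i = - \<mu>\<^sup>2" "0 \<le> \<mu>" using T_nonneg by (auto simp: S_def)
    then show "\<mu> \<in> (\<lambda>i. sqrt (- \<nu> i)) ` {..<k}" by (intro image_eqI[of _ _ i]) auto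
  qed
  then have "card S \<le> card {..<k}" by (rule surj_card_le[rotated]) simp
  then have cardS: "card S \<le> k" by simp
  have ST: "S \<subseteq> T" "finite S" using T(1) by (auto simp: S_def)
  have hP: "is_spectral_projection A g vol \<mu> (\<lambda>p. f p - P p) (h \<mu>)" if \<mu>: "\<mu> \<in> T - S" for \<mu>
  proof -
    have hE: "h \<mu> \<in> laplace_eigenspace A g (- \<mu>\<^sup>2)"
      using hT \<mu> by (simp add: is_spectral_projection_def orthogonal_projection_def)
    have "L2_inner vol (\<lambda>p. f p - P p - h \<mu> p) v = 0" if v: "v \<in> laplace_eigenspace A g (- \<mu>\<^sup>2)" for v
    proof -
      note vL2 = eigenspace_L2[OF v] and hL2 = eigenspace_L2[OF hE]
      have "L2_inner vol P v = (\<Sum>i<k. c i * L2_inner vol (u i) v)"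
        unfolding P_eq L2_inner_mult_left[symmetric]
        by (rule L2_inner_sum_left[OF _ vL2]) (simp add: cuL2)
      also have "\<dots> = 0"
      proof (rule sum.neutral, rule ballI)
        fix i assume "i \<in> {..<k}"
        moreover from this have "\<nu> i \<noteq> - \<mu>\<^sup>2" using \<mu> by (auto simp: S_def)
        ultimately show "c i * L2_inner vol (u i) v = 0" using eigenspaces_orthogonal[OF \<nu> v] by simp
      qed
      finally have Pv: "L2_inner vol P v = 0" .
      have "L2_inner vol (\<lambda>p. f p - h \<mu> p) v = 0"
        using hT \<mu> v by (simp add: is_spectral_projection_def orthogonal_projection_def)
      then show ?thesis
        using Pv by (simp add: L2_inner_diff_left L2_space_diff f PL2 vL2 hL2)
    qed
    with hE show ?thesis by (simp add: is_spectral_projection_def orthogonal_projection_def)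
  qed
  have "(\<Sum>\<mu>\<in>T. L2_norm vol (h \<mu>)) = (\<Sum>\<mu>\<in>S. L2_norm vol (h \<mu>)) + (\<Sum>\<mu>\<in>T - S. L2_norm vol (h \<mu>))"
    using sum.subset_diff[OF ST(1) T(1)] by (simp add: add.commute)
  also have "\<dots> \<le> sqrt (real (card S)) * L2_norm vol f
      + sqrt (real (card (T - S))) * L2_norm vol (\<lambda>p. f p - P p)"
    by (intro add_mono sum_projection_norms_le f L2_space_diff PL2 hP hT T_nonneg finite_Diff T(1) ST(2))
      (use ST in auto)
  also have "\<dots> \<le> sqrt (real k) * L2_norm vol f
      + sqrt (real (card {j. lam j \<le> \<Lambda>})) * L2_norm vol (\<lambda>p. f p - P p)"
    using cardS T(2) card_mono[OF T(1), of "T - S"]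
    by (intro add_mono mult_right_mono) (auto simp: L2_norm_nonneg)
  finally show ?thesis unfolding l1 by (rule ennreal_leI)
qed

end

theorem theorem1p11:
  fixes A :: "('m::t2_space, 'n::finite) chart set"
    and g :: "('m, 'n) metric_components"
    and vol :: "'m measure"
    and e :: "nat \<Rightarrow> 'm \<Rightarrow> complex"
    and lam :: "nat \<Rightarrow> real"
    and \<Lambda> \<eta> :: real
    and f P :: "'m \<Rightarrow> complex"
    and k :: nat
  assumes "compact_riemannian_manifold A g"
    and "riemannian_volume A g vol"
    and "laplace_eigenbasis A g vol e lam"
    and "\<Lambda> > 0"
    and "f \<in> L2_space vol"
    and "band_limited A g vol lam \<Lambda> f"
    and "\<not> (AE x in vol. f x = 0)"
    and "eigenfunction_combination A g k P"
    and "0 < \<eta>" and "\<eta> < 1"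
    and "L2_norm vol (\<lambda>x. f x - P x) \<le> \<eta> * L2_norm vol f"
  shows "fourier_ratio A g vol lam f
           \<le> ennreal ((1 + \<eta>) * sqrt (real k)) + ennreal \<eta> * ennreal_sqrt (weyl_count lam \<Lambda>)"
proof (cases "finite {j. lam j \<le> \<Lambda>}")
  \<comment> \<open>If infinitely many basis elements lie below \<open>\<Lambda>\<close>, the right-hand side is infinite as \<open>\<eta> > 0\<close>.\<close>
  case False
  then have "ennreal_sqrt (weyl_count lam \<Lambda>) = \<infinity>"
    by (simp add: weyl_count_def ennreal_sqrt_def)
  then show ?thesis using \<open>0 < \<eta>\<close> by (simp add: ennreal_mult_eq_top_iff)
next
  case True
  interpret compact_riemannian_space A g vol
    using assms(1,2) by unfold_locales
  let ?N = "card {j. lam j \<le> \<Lambda>}" and ?F = "L2_norm vol f"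
  have F: "?F > 0"
    using L2_norm_eq_0_iff[OF assms(5)] assms(7) L2_norm_nonneg[of vol f] by linarith
  have "sqrt (real k) * ?F + sqrt (real ?N) * L2_norm vol (\<lambda>x. f x - P x)
      \<le> (1 + \<eta>) * sqrt (real k) * ?F + sqrt (real ?N) * (\<eta> * ?F)"
  proof (rule add_mono)
    have "1 * (sqrt (real k) * ?F) \<le> (1 + \<eta>) * (sqrt (real k) * ?F)"
      using F \<open>0 < \<eta>\<close> by (intro mult_right_mono) auto
    then show "sqrt (real k) * ?F \<le> (1 + \<eta>) * sqrt (real k) * ?F" by (simp add: mult.assoc)
    show "sqrt (real ?N) * L2_norm vol (\<lambda>x. f x - P x) \<le> sqrt (real ?N) * (\<eta> * ?F)"
      using assms(11) by (intro mult_left_mono) auto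
  qed
  also have "\<dots> = ((1 + \<eta>) * sqrt (real k) + \<eta> * sqrt (real ?N)) * ?F" by (simp add: algebra_simps)
  finally have "fourier_l1_norm A g vol lam f
      \<le> ennreal (((1 + \<eta>) * sqrt (real k) + \<eta> * sqrt (real ?N)) * ?F)"
    using fourier_l1_norm_bound[OF assms(3,5,6) True assms(8)] by (meson ennreal_leI order_trans)
  then have "fourier_ratio A g vol lam f
      \<le> ennreal (((1 + \<eta>) * sqrt (real k) + \<eta> * sqrt (real ?N)) * ?F) / ennreal ?F"
    unfolding fourier_ratio_def by (rule divide_right_mono_ennreal)
  also have "\<dots> = ennreal ((1 + \<eta>) * sqrt (real k) + \<eta> * sqrt (real ?N))"
    using F \<open>0 < \<eta>\<close> by (subst divide_ennreal) auto
  also have "\<dots> = ennreal ((1 + \<eta>) * sqrt (real k)) + ennreal \<eta> * ennreal (sqrt (real ?N))"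
    using \<open>0 < \<eta>\<close> by (simp add: ennreal_plus ennreal_mult)
  also have "ennreal (sqrt (real ?N)) = ennreal_sqrt (weyl_count lam \<Lambda>)"
    using True by (simp add: weyl_count_def ennreal_sqrt_def ennreal_of_nat_eq_real_of_nat)
  finally show ?thesis .
qed

end
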